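(* Let $X=(X,+,\cdot)$ be a finite left nilpotent skew brace. Then \[ \ell(X)\leq \max\bigl\{\ell(P)\mid P\in \operatorname{Syl}_{p}(X),\ p\in\pi(X)\bigr\}+1, \] where $\pi(X)$ is the set of primes dividing $|X|$, $\operatorname{Syl}_{p}(X)$ denotes the set of all Sylow $p$-subbraces of $X$, and $\ell$ denotes the left nilpotency class.
   Context: A skew (left) brace is a triple $(X,+,\cdot)$ where $(X,+)$ and $(X,\cdot)$ are groups (neither assumed abelian) such that $x\cdot(y+z)=x\cdot y-x+x\cdot z$ for all $x,y,z\in X$. The two groups have the same identity element, denoted $0$. A nonempty subset $S\subseteq X$ is a subbrace if it is a subgroup of both $(X,+)$ and $(X,\cdot)$; it is then itself a skew brace. The star operation is $x*y=-x+x\cdot y-y$. The left series of $X$ is defined by $X^1=X$ and $X^{n+1}=X*X^n$, the subgroup of $(X,+)$ generated by all $a*x$ with $a\in X$, $x\in X^n$. $X$ is left nilpotent if $X^m=0$ (i.e. $X^m=\{0\}$) for some positive integer $m$; its left nilpotency class $\ell(X)$ is then the smallest positive integer $n$ such that $X^{n+1}=0$. A subbrace of a left nilpotent skew brace is left nilpotent. For a prime $p$ dividing $|X|$, a Sylow $p$-subbrace of $X$ is a subbrace of order $|X|_p$, the $p$-part of $|X|$. In the degenerate case $|X|=1$ the maximum over the empty set is read as $0$. *)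

theory Defs
  imports
    "HOL-Algebra.Ring"
    "HOL-Algebra.Generated_Groups"
    "HOL-Computational_Algebra.Primes"
begin

text \<open>
  The record type of rings is used only as a signature with two binary operations;
  neither group is assumed abelian. The additive operations bracket to the left, so
  \<open>x \<otimes> y \<ominus> x \<oplus> x \<otimes> z\<close> is \<open>((x \<otimes> y) \<ominus> x) \<oplus> (x \<otimes> z)\<close>.
\<close>

locale skew_brace =
  fixes X :: "('a, 'm) ring_scheme" (structure)
  assumes add_group: "group (add_monoid X)"
    and mult_group: "group X"
    and brace_distrib:
      "\<lbrakk>x \<in> carrier X; y \<in> carrier X; z \<in> carrier X\<rbrakk>
        \<Longrightarrow> x \<otimes> (y \<oplus> z) = x \<otimes> y \<ominus> x \<oplus> x \<otimes> z"

definition subbrace :: "'a set \<Rightarrow> ('a, 'm) ring_scheme \<Rightarrow> bool" where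
  "subbrace S X \<longleftrightarrow> subgroup S (add_monoid X) \<and> subgroup S X"

definition star :: "('a, 'm) ring_scheme \<Rightarrow> 'a \<Rightarrow> 'a \<Rightarrow> 'a" where
  "star X x y = \<ominus>\<^bsub>X\<^esub> x \<oplus>\<^bsub>X\<^esub> x \<otimes>\<^bsub>X\<^esub> y \<ominus>\<^bsub>X\<^esub> y"

text \<open>
  The left series is indexed from 1; the value at index 0 is a dummy.
\<close>

fun left_series :: "('a, 'm) ring_scheme \<Rightarrow> nat \<Rightarrow> 'a set" where
  "left_series X 0 = carrier X"
| "left_series X (Suc 0) = carrier X"
| "left_series X (Suc (Suc n)) =
     generate (add_monoid X) {star X a x | a x. a \<in> carrier X \<and> x \<in> left_series X (Suc n)}"

definition left_nilpotent :: "('a, 'm) ring_scheme \<Rightarrow> bool" where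
  "left_nilpotent X \<longleftrightarrow> (\<exists>m>0. left_series X m = {\<zero>\<^bsub>X\<^esub>})"

text \<open>
  Meaningful only for left nilpotent \<open>X\<close>. The class is at least 1, also for the
  trivial skew brace.
\<close>

definition left_class :: "('a, 'm) ring_scheme \<Rightarrow> nat" where
  "left_class X = (LEAST n. n > 0 \<and> left_series X (n + 1) = {\<zero>\<^bsub>X\<^esub>})"

definition sylow_subbraces :: "nat \<Rightarrow> ('a, 'm) ring_scheme \<Rightarrow> 'a set set" where
  "sylow_subbraces p X = {P. subbrace P X \<and> card P = p ^ multiplicity p (order X)}"

lemma (in skew_brace) zero_eq_one: "\<zero> = \<one>"
proof -
  interpret A: group "add_monoid X" by (rule add_group)
  interpret M: group X by (rule mult_group)
  have z: "\<zero> \<in> carrier X" using A.one_closed by simp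
  have "\<one> \<otimes> (\<zero> \<oplus> \<zero>) = \<one> \<otimes> \<zero> \<ominus> \<one> \<oplus> \<one> \<otimes> \<zero>"
    by (rule brace_distrib) (use z in auto)
  then have "\<zero> = \<ominus> \<one>"
    using z A.l_one A.r_one A.inv_closed[of \<one>] by (simp add: a_minus_def a_inv_def)
  then show ?thesis
    using A.inv_inv[of \<one>] A.inv_one by (simp add: a_inv_def)
qed

lemma (in skew_brace) subbrace_skew_brace:
  assumes "subbrace S X"
  shows "skew_brace (X\<lparr>carrier := S\<rparr>)"
proof -
  interpret A: group "add_monoid X" by (rule add_group)
  interpret M: group X by (rule mult_group)
  have SA: "subgroup S (add_monoid X)" and SM: "subgroup S X"
    using assms by (auto simp: subbrace_def)
  have inv: "\<ominus>\<^bsub>X\<lparr>carrier := S\<rparr>\<^esub> x = \<ominus> x" if "x \<in> S" for x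
    using A.m_inv_consistent[OF SA that] by (simp add: a_inv_def)
  show ?thesis
  proof (rule skew_brace.intro)
    show "group (add_monoid (X\<lparr>carrier := S\<rparr>))"
      using A.subgroup_imp_group[OF SA] by simp
    show "group (X\<lparr>carrier := S\<rparr>)" by (rule M.subgroup_imp_group[OF SM])
  next
    fix x y z assume "x \<in> carrier (X\<lparr>carrier := S\<rparr>)" "y \<in> carrier (X\<lparr>carrier := S\<rparr>)"
      "z \<in> carrier (X\<lparr>carrier := S\<rparr>)"
    then show "x \<otimes>\<^bsub>X\<lparr>carrier := S\<rparr>\<^esub> (y \<oplus>\<^bsub>X\<lparr>carrier := S\<rparr>\<^esub> z) =
      x \<otimes>\<^bsub>X\<lparr>carrier := S\<rparr>\<^esub> y \<ominus>\<^bsub>X\<lparr>carrier := S\<rparr>\<^esub> x \<oplus>\<^bsub>X\<lparr>carrier := S\<rparr>\<^esub> x \<otimes>\<^bsub>X\<lparr>carrier := S\<rparr>\<^esub> z"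
      using brace_distrib[of x y z] subgroup.subset[OF SM] inv[of x]
      by (auto simp: a_minus_def)
  qed
qed

end

theory Submission
  imports Defs "HOL-Algebra.Sylow" "HOL-Algebra.Group_Action" "HOL-Algebra.Zassenhaus"
    "HOL-Algebra.Multiplicative_Group"
begin

text \<open>
  A multiplicative \<open>g\<close> acts on \<open>(X, +)\<close> by the automorphism \<open>\<lambda>\<^sub>g a = - g + g a\<close>, and
  \<open>g * a = \<lambda>\<^sub>g a - a\<close>; so \<open>X\<close> is left nilpotent iff this action stabilises the subnormal
  chain \<open>X\<^sup>1 \<ge> X\<^sup>2 \<ge> \<dots>\<close> of additive subgroups down to 0. Consequently, if the order of \<open>g\<close> is a power of \<open>p\<close>,
  then every \<open>g * a\<close> lies in the largest normal \<open>p\<close>-subgroup \<open>O\<^sub>p\<close> of \<open>(X, +)\<close>. In particular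
  \<open>q\<close>-elements with \<open>q \<noteq> p\<close> fix \<open>O\<^sub>p\<close> pointwise.

  Choose a Sylow subbrace \<open>P\<^sub>p\<close> for each \<open>p\<close>. It contains \<open>O\<^sub>p\<close>, and the \<open>P\<^sub>q\<close> together generate the
  multiplicative group. Hence \<open>X * (O\<^sub>p \<inter> P\<^sub>p\<^sup>n) \<subseteq> O\<^sub>p \<inter> P\<^sub>p\<^sup>n\<^sup>+\<^sup>1\<close>, and since \<open>X\<^sup>2\<close> is contained in the
  sum of the \<open>O\<^sub>p\<close>, induction shows that \<open>X\<^sup>n\<^sup>+\<^sup>1\<close> is contained in the sum of the \<open>O\<^sub>p \<inter> P\<^sub>p\<^sup>n\<close>.
\<close>

section \<open>Torsion and the p-core\<close>

text \<open>The condition is elementwise, with an exponent depending on the element, so it makes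
  sense for any subset and passes easily to subsets, unions and images.\<close>

definition p_torsion :: "nat \<Rightarrow> ('a, 'b) monoid_scheme \<Rightarrow> 'a set \<Rightarrow> bool" where
  "p_torsion p G H \<longleftrightarrow> (\<forall>x\<in>H. \<exists>k::nat. x [^]\<^bsub>G\<^esub> (p ^ k) = \<one>\<^bsub>G\<^esub>)"

text \<open>For finite \<open>G\<close> and prime \<open>p\<close> this is O_p(G). As a union it is
  maximal by construction; that it is a subgroup is the content of
  \<open>pcore_normal\<close>.\<close>

definition pcore :: "nat \<Rightarrow> ('a, 'b) monoid_scheme \<Rightarrow> 'a set" where
  "pcore p G = \<Union>{K. K \<lhd> G \<and> p_torsion p G K}"

lemma p_torsion_subset: "p_torsion p G K \<Longrightarrow> H \<subseteq> K \<Longrightarrow> p_torsion p G H"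
  by (auto simp: p_torsion_def)

lemma p_torsion_consistent: "p_torsion p (G\<lparr>carrier := B\<rparr>) H = p_torsion p G H"
  unfolding p_torsion_def nat_pow_def by simp

lemma (in group) inv_cancel:
  assumes "x \<in> carrier G" "y \<in> carrier G"
  shows "inv x \<otimes> (x \<otimes> y) = y" "x \<otimes> (inv x \<otimes> y) = y"
  using assms by (simp_all flip: m_assoc)

lemma (in group_hom) subgroup_vimage:
  assumes "subgroup K H"
  shows "subgroup {x \<in> carrier G. h x \<in> K} G"
proof (rule G.subgroupI)
  have "\<one>\<^bsub>G\<^esub> \<in> {x \<in> carrier G. h x \<in> K}" using subgroup.one_closed[OF assms] by simp
  then show "{x \<in> carrier G. h x \<in> K} \<noteq> {}" by blast
qed (use assms in \<open>auto simp: subgroup.m_closed subgroup.m_inv_closed\<close>)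

lemma (in group) subgroup_conj_vimage:
  assumes "subgroup K G" "x \<in> carrier G"
  shows "subgroup {y \<in> carrier G. x \<otimes> y \<otimes> inv x \<in> K} G"
proof (rule group_hom.subgroup_vimage[OF _ assms(1)])
  show "group_hom G G (\<lambda>y. x \<otimes> y \<otimes> inv x)"
    using assms(2) by (auto simp: group_hom_def group_hom_axioms_def hom_def m_assoc inv_cancel)
qed

text \<open>For a generating set closed under inverses no induction step for inverses is needed; the
  case named \<open>inv\<close> is that closure condition itself.\<close>

lemma (in group) generate_induct_inv_closed [consumes 2, case_names inv one incl mult]:
  assumes "x \<in> generate G H" "H \<subseteq> carrier G" "\<And>h. h \<in> H \<Longrightarrow> inv h \<in> H"
    and "P \<one>" "\<And>h. h \<in> H \<Longrightarrow> P h"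
    and "\<And>x y. \<lbrakk>x \<in> generate G H; y \<in> generate G H; P x; P y\<rbrakk> \<Longrightarrow> P (x \<otimes> y)"
  shows "P x"
  using assms(1) by induction (use assms in auto)

lemma (in group) one_of_coprime_pow:
  fixes m n :: nat
  assumes "x \<in> carrier G" "x [^] m = \<one>" "x [^] n = \<one>" "coprime m n"
  shows "x = \<one>"
proof -
  have "ord x dvd m" "ord x dvd n" using assms pow_eq_id by auto
  then have "ord x = 1" using assms(4) by (meson coprime_common_divisor_nat nat_dvd_1_iff_1 coprime_def is_unit_gcd_iff dvd_1_iff_1)
  then show ?thesis using pow_ord_eq_1[OF assms(1)] assms(1) by simp
qed

lemma (in group) p_torsion_if_card:
  assumes "subgroup H G" "card H = p ^ k"
  shows "p_torsion p G H"
  unfolding p_torsion_def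
proof
  fix x assume x: "x \<in> H"
  interpret H: group "G\<lparr>carrier := H\<rparr>" by (rule subgroup_imp_group[OF assms(1)])
  have "x [^]\<^bsub>G\<lparr>carrier := H\<rparr>\<^esub> (p ^ k) = \<one>"
    using H.pow_order_eq_1[of x] x assms by (simp add: order_def)
  then show "\<exists>k::nat. x [^] (p ^ k) = \<one>"
    unfolding nat_pow_consistent[of x _ H] by blast
qed

text \<open>Otherwise some prime \<open>q\<close> other than \<open>p\<close> divides the order. A
  subgroup of order \<open>q\<close> would consist of elements killed by powers of both primes,
  hence be trivial.\<close>

lemma (in group) card_of_p_torsion:
  assumes "subgroup H G" "finite H" "prime p" "p_torsion p G H"
  shows "\<exists>k. card H = p ^ k"
proof (rule ccontr)
  assume no: "\<nexists>k. card H = p ^ k"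
  interpret H: group "G\<lparr>carrier := H\<rparr>" by (rule subgroup_imp_group[OF assms(1)])
  have pos: "card H \<noteq> 0" using subgroup.one_closed[OF assms(1)] assms(2) by auto
  obtain r where r: "card H = p ^ multiplicity p (card H) * r" "\<not> p dvd r"
    using multiplicity_decompose'[of "card H" p] pos not_prime_unit[of p] assms(3) by blast
  have "r \<noteq> 1" using no r(1) by (metis mult_1_right)
  then obtain q where q: "prime q" "q dvd r" using prime_factor_nat by blast
  then have "q \<noteq> p" using r(2) by auto
  have "q dvd card H" by (subst r(1)) (use q(2) in simp)
  \<comment> \<open>Sylow's theorem with exponent 1 serves as Cauchy's theorem.\<close>
  obtain m where "card H = q ^ 1 * m" using \<open>q dvd card H\<close> by auto
  then obtain K where K: "subgroup K (G\<lparr>carrier := H\<rparr>)" "card K = q ^ 1"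
    using sylow_thm[OF q(1) H.is_group, of 1 m] assms(2) by (auto simp: order_def)
  have "p_torsion q G K"
    using H.p_torsion_if_card[OF K] by (simp add: p_torsion_consistent)
  have "K = {\<one>}"
  proof -
    have "x = \<one>" if x: "x \<in> K" for x
    proof -
      have xH: "x \<in> H" using subgroup.subset[OF K(1)] x by auto
      then have xG: "x \<in> carrier G" using subgroup.subset[OF assms(1)] by auto
      obtain i where "x [^] (p ^ i) = \<one>" using assms(4) xH by (auto simp: p_torsion_def)
      moreover obtain j where "x [^] (q ^ j) = \<one>"
        using \<open>p_torsion q G K\<close> x by (auto simp: p_torsion_def)
      moreover have "coprime (p ^ i) (q ^ j)"
        using q \<open>q \<noteq> p\<close> assms(3) by (simp add: primes_coprime)
      ultimately show ?thesis using one_of_coprime_pow xG by blast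
    qed
    then have "K \<subseteq> {\<one>}" by blast
    moreover have "\<one> \<in> K" using subgroup.one_closed[OF K(1)] by simp
    ultimately show ?thesis by blast
  qed
  then show False using K(2) prime_gt_1_nat[OF q(1)] by simp
qed

lemma (in group) card_p_torsion_le:
  assumes "subgroup H G" "finite (carrier G)" "prime p" "p_torsion p G H"
  shows "card H \<le> p ^ multiplicity p (order G)"
proof -
  have fH: "finite H" using assms(1,2) subgroup.subset finite_subset by blast
  obtain k where k: "card H = p ^ k" using card_of_p_torsion assms fH by blast
  have "card H dvd order G" using lagrange[OF assms(1)] by (metis dvd_triv_right)
  moreover have "order G \<noteq> 0" using assms(2) order_gt_0_iff_finite by auto
  ultimately have "k \<le> multiplicity p (order G)"
    using k by (metis multiplicity_geI not_prime_unit assms(3))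
  then show ?thesis using k assms(3) prime_gt_0_nat by (metis power_increasing Suc_leI One_nat_def)
qed

lemma (in normal) pow_mem_iff:
  assumes "x \<in> carrier G"
  shows "(H #> x) [^]\<^bsub>G Mod H\<^esub> (n::nat) = \<one>\<^bsub>G Mod H\<^esub> \<longleftrightarrow> x [^] n \<in> H"
proof -
  have "H #> (x [^] n) = H \<longleftrightarrow> x [^] n \<in> H"
    using assms is_subgroup by (meson coset_join1 coset_join2 nat_pow_closed)
  then show ?thesis using assms FactGroup_pow[of x n] by simp
qed

text \<open>The exponents add: a power of \<open>x\<close> falls into \<open>N\<close>, and a
  further power kills it.\<close>

lemma (in group) p_torsion_extension:
  assumes N: "N \<lhd> G" and tN: "p_torsion p G N"
    and tK: "p_torsion p (G Mod N) ((#>) N ` M)" and M: "M \<subseteq> carrier G"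
  shows "p_torsion p G M"
  unfolding p_torsion_def
proof
  fix x assume x: "x \<in> M"
  interpret normal N G by fact
  obtain k where "(N #> x) [^]\<^bsub>G Mod N\<^esub> (p ^ k) = \<one>\<^bsub>G Mod N\<^esub>"
    using tK x by (auto simp: p_torsion_def)
  then have "x [^] (p ^ k) \<in> N" using pow_mem_iff x M by blast
  then obtain j where "(x [^] (p ^ k)) [^] (p ^ j) = \<one>" using tN by (auto simp: p_torsion_def)
  then show "\<exists>k::nat. x [^] (p ^ k) = \<one>"
    using x M by (metis nat_pow_pow power_add subsetD)
qed

text \<open>Modulo \<open>L\<close> the product has the same image as \<open>K\<close>, so
  \<open>p_torsion_extension\<close> applies.\<close>

lemma (in group) p_torsion_mult:
  assumes K: "subgroup K G" "p_torsion p G K" and L: "L \<lhd> G" "p_torsion p G L"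
  shows "p_torsion p G (L <#> K)"
proof (rule p_torsion_extension[OF L])
  interpret L: normal L G by fact
  have KG: "K \<subseteq> carrier G" using subgroup.subset K by auto
  show "L <#> K \<subseteq> carrier G" using KG L.subset setmult_subset_G by blast
  show "p_torsion p (G Mod L) ((#>) L ` (L <#> K))"
    unfolding p_torsion_def
  proof
    fix z assume "z \<in> (#>) L ` (L <#> K)"
    then obtain l x where lx: "l \<in> L" "x \<in> K" "z = L #> (l \<otimes> x)" by (auto simp: set_mult_def)
    then have z: "z = L #> x"
      using KG L.subset coset_mult_assoc[of L l x] coset_join2[of l L] L.is_subgroup by auto
    obtain k where "x [^] (p ^ k) = \<one>" using K(2) lx by (auto simp: p_torsion_def)
    then show "\<exists>k::nat. z [^]\<^bsub>G Mod L\<^esub> (p ^ k) = \<one>\<^bsub>G Mod L\<^esub>"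
      using L.pow_mem_iff[of x "p ^ k"] lx KG z L.one_closed by auto
  qed
qed

lemma (in group) normal_set_mult:
  assumes "K \<lhd> G" "L \<lhd> G"
  shows "L <#> K \<lhd> G"
proof (rule normal_invI)
  show "subgroup (L <#> K) G" using assms mult_norm_subgroup normal_imp_subgroup by blast
  fix x h assume x: "x \<in> carrier G" and h: "h \<in> L <#> K"
  then obtain l k where lk: "l \<in> L" "k \<in> K" "h = l \<otimes> k" by (auto simp: set_mult_def)
  have c: "l \<in> carrier G" "k \<in> carrier G"
    using lk assms normal_imp_subgroup subgroup.mem_carrier by metis+
  have "x \<otimes> h \<otimes> inv x = (x \<otimes> l \<otimes> inv x) \<otimes> (x \<otimes> k \<otimes> inv x)"
    using x c lk by (simp add: m_assoc inv_cancel)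
  moreover have "x \<otimes> l \<otimes> inv x \<in> L" "x \<otimes> k \<otimes> inv x \<in> K"
    using assms lk x by (simp_all add: normal.inv_op_closed2)
  ultimately show "x \<otimes> h \<otimes> inv x \<in> L <#> K" by (auto simp: set_mult_def)
qed

lemma (in group) subset_pcore: "K \<lhd> G \<Longrightarrow> p_torsion p G K \<Longrightarrow> K \<subseteq> pcore p G"
  by (auto simp: pcore_def)

lemma p_torsion_pcore: "p_torsion p G (pcore p G)"
  by (auto simp: pcore_def p_torsion_def)

text \<open>Two elements of the union lie in normal p-torsion subgroups \<open>K\<close> and
  \<open>L\<close>, and \<open>K <#> L\<close> is again normal and p-torsion.\<close>

lemma (in group) pcore_normal: "pcore p G \<lhd> G"
proof (rule normal_invI)
  have one: "{\<one>} \<lhd> G" "p_torsion p G {\<one>}" by (auto simp: one_is_normal p_torsion_def)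
  show "subgroup (pcore p G) G"
  proof (rule subgroupI)
    show "pcore p G \<subseteq> carrier G"
      unfolding pcore_def using normal_imp_subgroup subgroup.subset by blast
    show "pcore p G \<noteq> {}" using one subset_pcore by blast
    fix a assume "a \<in> pcore p G"
    then obtain K where K: "K \<lhd> G" "p_torsion p G K" "a \<in> K" by (auto simp: pcore_def)
    then have "inv a \<in> K" by (simp add: normal_imp_subgroup subgroup.m_inv_closed)
    then show "inv a \<in> pcore p G" using K subset_pcore by blast
    fix b assume "b \<in> pcore p G"
    then obtain L where L: "L \<lhd> G" "p_torsion p G L" "b \<in> L" by (auto simp: pcore_def)
    have "K <#> L \<lhd> G" "p_torsion p G (K <#> L)"
      using normal_set_mult[OF L(1) K(1)] p_torsion_mult[of L p K] L K normal_imp_subgroup by auto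
    moreover have "a \<otimes> b \<in> K <#> L" using K(3) L(3) by (auto simp: set_mult_def)
    ultimately show "a \<otimes> b \<in> pcore p G" using subset_pcore by blast
  qed
  fix x h assume "x \<in> carrier G" "h \<in> pcore p G"
  then show "x \<otimes> h \<otimes> inv x \<in> pcore p G"
    using normal.inv_op_closed2 unfolding pcore_def by fastforce
qed

text \<open>Surjectivity makes the image of a normal subgroup normal, and a homomorphism preserves
  p-torsion.\<close>

lemma (in group) pcore_hom_closed:
  assumes f: "f \<in> hom G G" "f ` carrier G = carrier G" and x: "x \<in> pcore p G"
  shows "f x \<in> pcore p G"
proof -
  interpret f: group_hom G G f using f(1) by (simp add: group_hom_def group_hom_axioms_def)
  obtain K where K: "K \<lhd> G" "p_torsion p G K" "x \<in> K" using x by (auto simp: pcore_def)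
  interpret K: normal K G by fact
  have "f ` K \<lhd> G"
  proof (rule normal_invI)
    show "subgroup (f ` K) G" by (rule f.subgroup_img_is_subgroup[OF K.is_subgroup])
    fix y h assume "y \<in> carrier G" "h \<in> f ` K"
    then obtain y' h' where yh: "y' \<in> carrier G" "y = f y'" "h' \<in> K" "h = f h'" using f(2) by blast
    have "y \<otimes> h \<otimes> inv y = f (y' \<otimes> h' \<otimes> inv y')" using yh by simp
    moreover have "y' \<otimes> h' \<otimes> inv y' \<in> K" using K.inv_op_closed2 yh by auto
    ultimately show "y \<otimes> h \<otimes> inv y \<in> f ` K" by (metis imageI)
  qed
  moreover have "p_torsion p G (f ` K)"
    unfolding p_torsion_def
  proof
    fix z assume "z \<in> f ` K"
    then obtain y where y: "y \<in> K" "z = f y" by auto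
    then obtain k where "y [^] (p ^ k) = \<one>" using K(2) by (auto simp: p_torsion_def)
    then show "\<exists>k::nat. z [^] (p ^ k) = \<one>" using y f.hom_nat_pow[of y "p ^ k"] by auto
  qed
  ultimately show ?thesis using K(3) subset_pcore by blast
qed

text \<open>Conjugation by an element of \<open>G\<close> restricts to an automorphism of
  \<open>B\<close>, which preserves the core of \<open>B\<close>.\<close>

lemma (in group) pcore_of_normal_subset:
  assumes B: "B \<lhd> G"
  shows "pcore p (G\<lparr>carrier := B\<rparr>) \<lhd> G" "pcore p (G\<lparr>carrier := B\<rparr>) \<subseteq> pcore p G"
proof -
  interpret B: normal B G by fact
  interpret GB: group "G\<lparr>carrier := B\<rparr>" by (rule subgroup_imp_group[OF B.is_subgroup])
  let ?O = "pcore p (G\<lparr>carrier := B\<rparr>)"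
  show N: "?O \<lhd> G"
  proof (rule normal_invI)
    show "subgroup ?O G"
      using GB.pcore_normal incl_subgroup[OF B.is_subgroup] normal_imp_subgroup by blast
    fix x h assume x: "x \<in> carrier G" and h: "h \<in> ?O"
    let ?c = "\<lambda>b. x \<otimes> b \<otimes> inv x"
    have "?c \<in> hom (G\<lparr>carrier := B\<rparr>) (G\<lparr>carrier := B\<rparr>)"
      using x B.inv_op_closed2 by (auto simp: hom_def m_assoc inv_cancel)
    moreover have "?c ` B = B"
    proof
      show "?c ` B \<subseteq> B" using x B.inv_op_closed2 by auto
      show "B \<subseteq> ?c ` B"
      proof
        fix b assume b: "b \<in> B"
        then have "inv x \<otimes> b \<otimes> x \<in> B" "b = ?c (inv x \<otimes> b \<otimes> x)"
          using x B.inv_op_closed1 by (auto simp: m_assoc inv_cancel)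
        then show "b \<in> ?c ` B" by blast
      qed
    qed
    ultimately show "?c h \<in> ?O" using GB.pcore_hom_closed[of ?c h p] h by auto
  qed
  show "?O \<subseteq> pcore p G"
    using subset_pcore[OF N] p_torsion_pcore[of p "G\<lparr>carrier := B\<rparr>"] by (simp add: p_torsion_consistent)
qed

text \<open>The group generated by the core and \<open>d\<close> is again a normal \<open>p\<close>-subgroup, hence not larger than the core.\<close>

lemma (in group) mem_pcore_if_central_mod:
  assumes d: "d \<in> carrier G" and c: "\<And>b. b \<in> carrier G \<Longrightarrow> b \<otimes> d \<otimes> inv b \<otimes> inv d \<in> pcore p G"
    and pd: "d [^] (p ^ r) \<in> pcore p G"
  shows "d \<in> pcore p G"
proof -
  interpret O: normal "pcore p G" G by (rule pcore_normal)
  interpret Q: group "G Mod pcore p G" by (rule O.factorgroup_is_group)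
  let ?O = "pcore p G"
  \<comment> \<open>Generating from the whole coset of \<open>d\<close> makes the generating set
    invariant under conjugation: by \<open>c\<close>, conjugates of \<open>d\<close> stay in this
    coset.\<close>
  let ?T = "?O #> d"
  let ?N = "generate G ?T"
  have T: "?T \<subseteq> carrier G" using d O.subset r_coset_subset_G by auto
  have Tm: "t \<in> ?T \<longleftrightarrow> t \<in> carrier G \<and> t \<otimes> inv d \<in> ?O" for t
    using d O.rcos_module[OF is_group d, of t] T by blast
  have N: "?N \<lhd> G"
  proof (rule normal_generateI[OF T])
    fix t g assume t: "t \<in> ?T" and g: "g \<in> carrier G"
    have tG: "t \<in> carrier G" using t T by auto
    have "(g \<otimes> (t \<otimes> inv d) \<otimes> inv g) \<otimes> (g \<otimes> d \<otimes> inv g \<otimes> inv d) \<in> ?O"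
      using t g c O.inv_op_closed2 Tm by auto
    also have "(g \<otimes> (t \<otimes> inv d) \<otimes> inv g) \<otimes> (g \<otimes> d \<otimes> inv g \<otimes> inv d) = g \<otimes> t \<otimes> inv g \<otimes> inv d"
      using tG g d by (simp add: m_assoc inv_cancel)
    finally show "g \<otimes> t \<otimes> inv g \<in> ?T" using Tm g tG by simp
  qed
  have NG: "?N \<subseteq> carrier G" using generate_incl[OF T] .
  \<comment> \<open>All of \<open>?T\<close> is a single element of the quotient, so the image of
    \<open>?N\<close> lies in the cyclic group generated by the coset of \<open>d\<close>.\<close>
  have img: "?O #> x \<in> generate (G Mod ?O) {?O #> d}" if "x \<in> ?N" for x
    using that
  proof induction
    case one
    then show ?case using generate.one[of "G Mod ?O"] coset_join2[OF _ O.is_subgroup] by simp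
  next
    case (incl h)
    then have "?O #> h = ?O #> d" using repr_independence d O.is_subgroup by metis
    then show ?case using generate.incl[of "?O #> d" "{?O #> d}"] by simp
  next
    case (inv h)
    then have "?O #> h = ?O #> d" using repr_independence d O.is_subgroup by metis
    moreover have "inv\<^bsub>G Mod ?O\<^esub> (?O #> h) = ?O #> inv h"
      using O.inv_FactGroup[of "?O #> h"] O.rcos_inv[of h] inv T by (auto simp: carrier_FactGroup)
    ultimately show ?case using generate.inv[of "?O #> d" "{?O #> d}" "G Mod ?O"] by simp
  next
    case (eng h1 h2)
    then have "?O #> h1 \<otimes> h2 = (?O #> h1) \<otimes>\<^bsub>G Mod ?O\<^esub> (?O #> h2)"
      using O.rcos_sum[of h1 h2] NG by auto
    then show ?case using generate.eng[OF eng.IH] by metis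
  qed
  have "p_torsion p G ?N"
  proof (rule p_torsion_extension[OF pcore_normal p_torsion_pcore _ NG])
    show "p_torsion p (G Mod ?O) ((#>) ?O ` ?N)"
      unfolding p_torsion_def
    proof
      fix z assume "z \<in> (#>) ?O ` ?N"
      then have "z \<in> generate (G Mod ?O) {?O #> d}" using img by auto
      moreover have dQ: "?O #> d \<in> carrier (G Mod ?O)" using d by (simp add: carrier_FactGroup)
      ultimately obtain i :: int where z: "z = (?O #> d) [^]\<^bsub>G Mod ?O\<^esub> i"
        using Q.generate_pow by auto
      have 1: "(?O #> d) [^]\<^bsub>G Mod ?O\<^esub> (p ^ r) = \<one>\<^bsub>G Mod ?O\<^esub>"
        using O.pow_mem_iff d pd by blast
      have "z [^]\<^bsub>G Mod ?O\<^esub> (p ^ r) = (?O #> d) [^]\<^bsub>G Mod ?O\<^esub> (i * int (p ^ r))"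
        unfolding z by (metis Q.int_pow_pow dQ int_pow_int)
      also have "\<dots> = ((?O #> d) [^]\<^bsub>G Mod ?O\<^esub> (int (p ^ r))) [^]\<^bsub>G Mod ?O\<^esub> i"
        by (metis Q.int_pow_pow dQ mult.commute)
      also have "\<dots> = \<one>\<^bsub>G Mod ?O\<^esub>" unfolding int_pow_int 1 by (rule Q.int_pow_one)
      finally show "\<exists>k::nat. z [^]\<^bsub>G Mod ?O\<^esub> (p ^ k) = \<one>\<^bsub>G Mod ?O\<^esub>" by blast
    qed
  qed
  then have "?N \<subseteq> ?O" using subset_pcore N by blast
  moreover have "d \<in> ?N" using generate.incl Tm[of d] d by auto
  ultimately show ?thesis by blast
qed

text \<open>
  Modulo the core of \<open>B\<close>, the element \<open>d = f a a\<^sup>-\<^sup>1\<close> is central in \<open>B\<close> and fixed by \<open>f\<close>, so that \<open>f\<^sup>j a = d\<^sup>j a\<close>;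
  for \<open>j\<close> the order of \<open>f\<close> this shows that \<open>d\<close> has order a power of \<open>p\<close>.
\<close>

lemma (in group) displacement_mem_pcore:
  assumes B: "B \<lhd> G" and f: "f \<in> hom G G"
    and fp: "\<And>a. a \<in> carrier G \<Longrightarrow> (f ^^ (p ^ r)) a = a"
    and fB: "\<And>a. a \<in> carrier G \<Longrightarrow> f a \<otimes> inv a \<in> B"
    and fO: "\<And>b. b \<in> B \<Longrightarrow> f b \<otimes> inv b \<in> pcore p (G\<lparr>carrier := B\<rparr>)"
    and a: "a \<in> carrier G"
  shows "f a \<otimes> inv a \<in> pcore p G"
proof -
  let ?O = "pcore p (G\<lparr>carrier := B\<rparr>)"
  interpret B: normal B G by fact
  interpret GB: group "G\<lparr>carrier := B\<rparr>" by (rule subgroup_imp_group[OF B.is_subgroup])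
  interpret O: normal ?O G by (rule pcore_of_normal_subset[OF B])
  interpret f: group_hom G G f using f by (simp add: group_hom_def group_hom_axioms_def)
  have OB: "?O \<subseteq> B"
    using subgroup.subset[OF normal_imp_subgroup[OF GB.pcore_normal]] by simp
  define d where "d = f a \<otimes> inv a"
  have dB: "d \<in> B" using fB a d_def by simp
  have dG: "d \<in> carrier G" using dB B.subset by auto
  have fa: "f a = d \<otimes> a" using a by (simp add: d_def m_assoc)
  have central: "b' \<otimes> d \<otimes> inv b' \<otimes> inv d \<in> ?O" if b': "b' \<in> B" for b'
  proof -
    \<comment> \<open>With \<open>b' = a b a^-1\<close> one has
      \<open>f b' = f a (f b) (f a)^-1\<close>. Hence the commutator of \<open>b'\<close> and
      \<open>d\<close> is a product of the inverse displacement of \<open>b'\<close> and a conjugate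
      of the displacement of \<open>b\<close>, both in \<open>?O\<close>.\<close>
    define b where "b = inv a \<otimes> b' \<otimes> a"
    have bB: "b \<in> B" unfolding b_def using a b' B.inv_op_closed1 by simp
    have bG: "b \<in> carrier G" using bB B.subset by auto
    have b'b: "b' = a \<otimes> b \<otimes> inv a" 
      using a b' B.subset unfolding b_def by (auto simp: m_assoc inv_cancel subset_iff)
    have "inv (f b' \<otimes> inv b') \<in> ?O" using fO[OF b'] by (rule O.m_inv_closed)
    moreover have "d \<otimes> (a \<otimes> (f b \<otimes> inv b) \<otimes> inv a) \<otimes> inv d \<in> ?O"
      by (rule O.inv_op_closed2[OF dG O.inv_op_closed2[OF a fO[OF bB]]])
    ultimately have "inv (f b' \<otimes> inv b') \<otimes> (d \<otimes> (a \<otimes> (f b \<otimes> inv b) \<otimes> inv a) \<otimes> inv d) \<in> ?O"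
      by (rule O.m_closed)
    also have "inv (f b' \<otimes> inv b') \<otimes> (d \<otimes> (a \<otimes> (f b \<otimes> inv b) \<otimes> inv a) \<otimes> inv d)
      = b' \<otimes> d \<otimes> inv b' \<otimes> inv d"
      unfolding b'b d_def using a bG by (simp add: m_assoc inv_cancel inv_mult_group)
    finally show ?thesis .
  qed
  have pow: "\<exists>x\<in>?O. (f ^^ j) a = x \<otimes> d [^] j \<otimes> a" for j :: nat
  proof (induction j)
    case 0
    then show ?case using a O.one_closed by (intro bexI[of _ \<one>]) auto
  next
    case (Suc j)
    then obtain x where x: "x \<in> ?O" "(f ^^ j) a = x \<otimes> d [^] j \<otimes> a" by auto
    have xG: "x \<in> carrier G" using x O.subset by auto
    have "d [^] j \<in> B" using dB by (induction j) auto
    then have dj: "f (d [^] j) \<otimes> inv (d [^] j) \<in> ?O" using fO by blast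
    have "f x \<otimes> inv x \<otimes> x \<in> ?O" using fO x OB by blast
    then have "f x \<in> ?O" using xG by (simp add: m_assoc)
    then have "f x \<otimes> (f (d [^] j) \<otimes> inv (d [^] j)) \<in> ?O" using dj by blast
    moreover have "(f ^^ Suc j) a = f x \<otimes> (f (d [^] j) \<otimes> inv (d [^] j)) \<otimes> d [^] Suc j \<otimes> a"
      using x xG dG a fa by (simp add: m_assoc inv_cancel)
    ultimately show ?case by blast
  qed
  then obtain x where x: "x \<in> ?O" "a = x \<otimes> d [^] (p ^ r) \<otimes> a" using fp[OF a] by metis
  have xG: "x \<in> carrier G" using x O.subset by auto
  have "x \<otimes> d [^] (p ^ r) = \<one>"
    using x(2) a xG dG by (metis m_closed nat_pow_closed r_cancel_one)
  then have "d [^] (p ^ r) = inv x" using xG dG by (metis inv_equality inv_inv nat_pow_closed inv_closed)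
  then have "d [^] (p ^ r) \<in> ?O" using x by simp
  then have "d [^]\<^bsub>G\<lparr>carrier := B\<rparr>\<^esub> (p ^ r) \<in> ?O" unfolding nat_pow_consistent[of d _ B] .
  then have "d \<in> ?O"
    using GB.mem_pcore_if_central_mod[of d p r] central dB B.is_subgroup by simp
  then show ?thesis using pcore_of_normal_subset(2)[OF B] d_def by blast
qed

section \<open>Sylow subgroups\<close>

text \<open>Some orbit has length prime to \<open>p\<close>; its length also divides the group order
  \<open>p ^ k\<close>, so it is 1.\<close>

lemma (in group_action) fixed_point:
  assumes "order G = p ^ k" "prime p" "finite E" "\<not> p dvd card E"
  shows "\<exists>x\<in>E. \<forall>g\<in>carrier G. \<phi> g x = x"
proof -
  have "card E = (\<Sum>A\<in>orbits G E \<phi>. card A)"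
    using disjoint_sum[OF assms(3), of "\<lambda>_. 1::nat"] by simp
  then obtain A where A: "A \<in> orbits G E \<phi>" "\<not> p dvd card A"
    using assms(4) by (metis dvd_sum)
  then obtain x where x: "x \<in> E" "A = orbit G \<phi> x" by (auto simp: orbits_def)
  have "card A dvd p ^ k"
    using orbit_stabilizer_theorem[OF x(1)] x(2) assms(1) by (metis dvd_triv_left)
  then have "card A = 1"
    using A(2) assms(2) divides_primepow_nat[of p "card A" k] by (metis dvd_power gr0I power_0)
  then obtain y where "A = {y}" by (auto simp: card_1_singleton_iff)
  then have "\<forall>g\<in>carrier G. \<phi> g x = y" unfolding x(2) orbit_def by blast
  moreover have "x = y" using orbit_refl[OF x(1)] x(2) \<open>A = {y}\<close> by auto
  ultimately show ?thesis using x(1) by blast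
qed

text \<open>\<open>H\<close> acts by right multiplication on the right cosets of \<open>S\<close>,
  whose number is prime to \<open>p\<close>. A fixed coset \<open>S #> x\<close> yields the
  conjugating element.\<close>

lemma (in group) conjugate_subset_sylow:
  assumes fin: "finite (carrier G)" and p: "prime p"
    and S: "subgroup S G" "card S = p ^ multiplicity p (order G)"
    and H: "subgroup H G" "p_torsion p G H"
  shows "\<exists>x\<in>carrier G. \<forall>h\<in>H. x \<otimes> h \<otimes> inv x \<in> S"
proof -
  interpret H: group "G\<lparr>carrier := H\<rparr>" by (rule subgroup_imp_group[OF H(1)])
  have HG: "H \<subseteq> carrier G" and SG: "S \<subseteq> carrier G" using S H subgroup.subset by auto
  define E where "E = rcosets S"
  \<comment> \<open>The inverse turns right multiplication into a left action; the restriction to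
    \<open>E\<close> is what membership in \<open>Bij E\<close> demands.\<close>
  define \<phi> where "\<phi> = (\<lambda>h. \<lambda>R\<in>E. R #> inv h)"
  have E: "R \<subseteq> carrier G" if "R \<in> E" for R
    using that S subgroup.rcosets_carrier[OF S(1) is_group] E_def by auto
  have closed: "R #> g \<in> E" if "R \<in> E" "g \<in> carrier G" for R g
    using that SG coset_mult_assoc[of S _ g] by (auto simp: E_def RCOSETS_def)
  have "\<phi> h \<in> Bij E" if h: "h \<in> H" for h
  proof -
    have hG: "h \<in> carrier G" using h HG by auto
    have "bij_betw (\<phi> h) E E"
      by (rule bij_betw_byWitness[of _ "\<lambda>R. R #> h"])
        (use hG E closed in \<open>auto simp: \<phi>_def coset_mult_assoc\<close>)
    then show ?thesis by (simp add: Bij_def \<phi>_def)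
  qed
  moreover have "\<phi> (g \<otimes> h) = compose E (\<phi> g) (\<phi> h)" if "g \<in> H" "h \<in> H" for g h
    unfolding compose_def
  proof (rule ext)
    fix R
    have "g \<in> carrier G" "h \<in> carrier G" using that HG by auto
    then show "\<phi> (g \<otimes> h) R = (\<lambda>x\<in>E. \<phi> g (\<phi> h x)) R"
      using closed E by (auto simp: \<phi>_def coset_mult_assoc inv_mult_group)
  qed
  ultimately have "\<phi> \<in> hom (G\<lparr>carrier := H\<rparr>) (BijGroup E)"
    by (auto simp: hom_def BijGroup_def)
  then interpret act: group_action "G\<lparr>carrier := H\<rparr>" E \<phi>
    by (simp add: group_action_def group_hom_def group_hom_axioms_def group_BijGroup)
  have finE: "finite E" unfolding E_def RCOSETS_def using fin by auto
  have ordpos: "order G \<noteq> 0" using fin order_gt_0_iff_finite by auto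
  have "\<not> p dvd card E"
  proof
    assume "p dvd card E"
    moreover have "card E * p ^ multiplicity p (order G) = order G"
      using lagrange[OF S(1)] S(2) E_def by simp
    ultimately have "p ^ Suc (multiplicity p (order G)) dvd order G"
      by (metis mult_dvd_mono dvd_refl power_Suc)
    then show False using ordpos p
      by (metis Suc_n_not_le_n multiplicity_geI not_prime_unit)
  qed
  moreover obtain k where "order (G\<lparr>carrier := H\<rparr>) = p ^ k"
    using card_of_p_torsion[OF H(1) _ p H(2)] finite_subset[OF HG fin] by (auto simp: order_def)
  ultimately obtain R where R: "R \<in> E" "\<forall>h\<in>H. \<phi> h R = R"
    using act.fixed_point[OF _ p finE, of k] by auto
  then obtain x where x: "x \<in> carrier G" "R = S #> x" by (auto simp: E_def RCOSETS_def)
  have "x \<otimes> h \<otimes> inv x \<in> S" if h: "h \<in> H" for h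
  proof -
    have h': "inv h \<in> H" "h \<in> carrier G" using h H HG subgroup.m_inv_closed by auto
    then have "S #> x #> h = S #> x" using R x h' by (auto simp: \<phi>_def)
    then have "S #> (x \<otimes> h) = S #> x" using SG x h' by (simp add: coset_mult_assoc)
    then have "x \<otimes> h \<in> S #> x" using S(1) x h' by (metis m_closed rcos_self)
    then show ?thesis using subgroup.rcos_module_imp[OF S(1) is_group x(1)] by blast
  qed
  then show ?thesis using x by blast
qed

lemma (in group) sylow_exists:
  assumes "finite (carrier G)" "prime p"
  shows "\<exists>S. subgroup S G \<and> card S = p ^ multiplicity p (order G)"
proof -
  have "p ^ multiplicity p (order G) dvd order G" by (rule multiplicity_dvd)
  then show ?thesis using sylow_thm[OF assms(2) is_group _ assms(1)] by (metis dvdE)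
qed

text \<open>The intersection is a p-torsion subgroup of \<open>U\<close>, which bounds it above;
  conjugation by \<open>u\<close> embeds \<open>P\<close> into it, which bounds it below.\<close>

lemma (in group) conjugate_sylow_Int_card:
  assumes fin: "finite (carrier G)" and p: "prime p"
    and S: "subgroup S G" "p_torsion p G S"
    and U: "subgroup U G" and P: "P \<subseteq> U" "card P = p ^ multiplicity p (card U)"
    and u: "u \<in> U" "\<And>x. x \<in> P \<Longrightarrow> u \<otimes> x \<otimes> inv u \<in> S"
  shows "card (S \<inter> U) = p ^ multiplicity p (card U)"
proof (rule antisym)
  interpret U: group "G\<lparr>carrier := U\<rparr>" by (rule subgroup_imp_group[OF U])
  have UG: "U \<subseteq> carrier G" using U subgroup.subset by auto
  have finU: "finite U" using finite_subset[OF UG fin] .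
  have "subgroup (S \<inter> U) (G\<lparr>carrier := U\<rparr>)"
    using subgroup_incl[of "S \<inter> U" U] subgroups_Inter_pair[OF S(1) U] U by auto
  then show "card (S \<inter> U) \<le> p ^ multiplicity p (card U)"
    using U.card_p_torsion_le[of "S \<inter> U" p] p_torsion_subset[OF S(2), of "S \<inter> U"] finU p
    by (simp add: order_def p_torsion_consistent)
  have uG: "u \<in> carrier G" using u UG by auto
  have "inj_on (\<lambda>x. u \<otimes> x \<otimes> inv u) P"
    by (rule inj_on_inverseI[of _ "\<lambda>y. inv u \<otimes> y \<otimes> u"])
      (use uG P UG in \<open>auto simp: m_assoc inv_cancel subset_iff\<close>)
  moreover have "(\<lambda>x. u \<otimes> x \<otimes> inv u) ` P \<subseteq> S \<inter> U"
    using u P U by (auto intro!: subgroup.m_closed[OF U] subgroup.m_inv_closed[OF U])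
  ultimately show "p ^ multiplicity p (card U) \<le> card (S \<inter> U)"
    using card_inj_on_le[of _ P "S \<inter> U"] P(2) finU by auto
qed

text \<open>
  Some conjugate of \<open>U\<close>'s and some conjugate of \<open>V\<close>'s Sylow subgroup lie in the same Sylow subgroup;
  because \<open>G = U V\<close>, the conjugating elements can be moved into \<open>U\<close> and \<open>V\<close>.
\<close>

theorem (in group) factorized_sylow:
  assumes fin: "finite (carrier G)" and p: "prime p"
    and U: "subgroup U G" and V: "subgroup V G" and UV: "carrier G \<subseteq> U <#> V"
  shows "\<exists>S. subgroup S G \<and> p_torsion p G S \<and> card (S \<inter> U) = p ^ multiplicity p (card U)
    \<and> card (S \<inter> V) = p ^ multiplicity p (card V)"
proof -
  have UG: "U \<subseteq> carrier G" and VG: "V \<subseteq> carrier G" using U V subgroup.subset by auto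
  have sub: "\<exists>P. P \<subseteq> W \<and> subgroup P G \<and> p_torsion p G P \<and> card P = p ^ multiplicity p (card W)"
    if W: "subgroup W G" for W
  proof -
    interpret W: group "G\<lparr>carrier := W\<rparr>" by (rule subgroup_imp_group[OF W])
    have "finite W" using W fin subgroup.subset finite_subset by blast
    then obtain P where P: "subgroup P (G\<lparr>carrier := W\<rparr>)" "card P = p ^ multiplicity p (card W)"
      using W.sylow_exists[OF _ p] by (auto simp: order_def)
    have "P \<subseteq> W" using subgroup.subset[OF P(1)] by simp
    moreover have "subgroup P G" using incl_subgroup[OF W P(1)] .
    ultimately show ?thesis using P(2) p_torsion_if_card by blast
  qed
  obtain P where P: "P \<subseteq> U" "subgroup P G" "p_torsion p G P" "card P = p ^ multiplicity p (card U)"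
    using sub[OF U] by blast
  obtain Q where Q: "Q \<subseteq> V" "subgroup Q G" "p_torsion p G Q" "card Q = p ^ multiplicity p (card V)"
    using sub[OF V] by blast
  obtain S where S: "subgroup S G" "card S = p ^ multiplicity p (order G)"
    using sylow_exists[OF fin p] by blast
  obtain x where x: "x \<in> carrier G" "\<And>h. h \<in> P \<Longrightarrow> x \<otimes> h \<otimes> inv x \<in> S"
    using conjugate_subset_sylow[OF fin p S P(2,3)] by blast
  obtain y where y: "y \<in> carrier G" "\<And>h. h \<in> Q \<Longrightarrow> y \<otimes> h \<otimes> inv y \<in> S"
    using conjugate_subset_sylow[OF fin p S Q(2,3)] by blast
  have "inv x \<otimes> y \<in> carrier G" using x y by simp
  then have "inv x \<otimes> y \<in> U <#> V" using UV by blast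
  then obtain u v where uv: "u \<in> U" "v \<in> V" "inv x \<otimes> y = u \<otimes> v" by (auto simp: set_mult_def)
  have uvG: "u \<in> carrier G" "v \<in> carrier G" using uv UG VG by auto
  have y_eq: "y = x \<otimes> u \<otimes> v" using uv(3) x y uvG by (metis inv_cancel(2) m_assoc)
  \<comment> \<open>Since \<open>y = x u v\<close>, also \<open>w = y v^-1\<close>. Conjugating
    \<open>S\<close> back by \<open>w\<close> gives a subgroup \<open>T\<close> that contains both
    \<open>u^-1 P u\<close>, inside \<open>U\<close>, and \<open>v Q v^-1\<close>, inside
    \<open>V\<close>.\<close>
  define w where "w = x \<otimes> u"
  have w: "w \<in> carrier G" using x uvG w_def by simp
  define T where "T = {s \<in> carrier G. w \<otimes> s \<otimes> inv w \<in> S}"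
  have T: "subgroup T G"
    unfolding T_def by (rule subgroup_conj_vimage[OF S(1) w])
  have SG: "S \<subseteq> carrier G" using S subgroup.subset by auto
  have tT: "p_torsion p G T"
  proof (rule p_torsion_if_card[OF T])
    have "bij_betw (\<lambda>s. w \<otimes> s \<otimes> inv w) T S"
    proof (rule bij_betw_byWitness[of _ "\<lambda>s. inv w \<otimes> s \<otimes> w"])
      show "\<forall>s\<in>T. inv w \<otimes> (w \<otimes> s \<otimes> inv w) \<otimes> w = s"
        using w by (simp add: T_def m_assoc inv_cancel)
      show "\<forall>s\<in>S. w \<otimes> (inv w \<otimes> s \<otimes> w) \<otimes> inv w = s"
        using w SG by (auto simp: m_assoc inv_cancel subset_iff)
      show "(\<lambda>s. w \<otimes> s \<otimes> inv w) ` T \<subseteq> S" by (auto simp: T_def)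
      show "(\<lambda>s. inv w \<otimes> s \<otimes> w) ` S \<subseteq> T"
        using w SG by (auto simp: T_def m_assoc inv_cancel subset_iff)
    qed
    then show "card T = p ^ multiplicity p (order G)" using S(2) bij_betw_same_card by metis
  qed
  have "card (T \<inter> U) = p ^ multiplicity p (card U)"
  proof (rule conjugate_sylow_Int_card[OF fin p T tT U P(1,4), of "inv u"])
    show "inv u \<in> U" by (rule subgroup.m_inv_closed[OF U uv(1)])
    fix h assume h: "h \<in> P"
    then have "h \<in> carrier G" using P UG by auto
    then show "inv u \<otimes> h \<otimes> inv (inv u) \<in> T"
      using x(1) x(2)[OF h] uvG by (simp add: T_def w_def m_assoc inv_cancel inv_mult_group)
  qed
  moreover have "card (T \<inter> V) = p ^ multiplicity p (card V)"
  proof (rule conjugate_sylow_Int_card[OF fin p T tT V Q(1,4) uv(2)])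
    fix h assume h: "h \<in> Q"
    then have "h \<in> carrier G" using Q VG by auto
    then show "v \<otimes> h \<otimes> inv v \<in> T"
      using y(2)[OF h] x uvG unfolding y_eq by (simp add: T_def w_def m_assoc inv_cancel inv_mult_group)
  qed
  ultimately show ?thesis using T tT by blast
qed

text \<open>The product of the core with \<open>P\<close> is a p-torsion subgroup, and
  \<open>P\<close> already has the largest possible order of such a subgroup.\<close>

lemma (in group) pcore_subset_sylow:
  assumes "finite (carrier G)" "prime p" "subgroup P G" "card P = p ^ multiplicity p (order G)"
  shows "pcore p G \<subseteq> P"
proof -
  let ?Q = "pcore p G <#> P"
  have PG: "P \<subseteq> carrier G" and OG: "pcore p G \<subseteq> carrier G"
    using assms(3) pcore_normal normal_imp_subgroup subgroup.subset by blast+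
  have Q: "subgroup ?Q G" by (rule mult_norm_subgroup[OF pcore_normal assms(3)])
  have "p_torsion p G ?Q"
    using p_torsion_mult assms pcore_normal p_torsion_pcore p_torsion_if_card by metis
  then have "card ?Q \<le> card P" using card_p_torsion_le[OF Q] assms by simp
  moreover have "P \<subseteq> ?Q"
  proof
    fix x assume "x \<in> P"
    then have "\<one> \<otimes> x \<in> ?Q"
      using subgroup.one_closed[OF normal_imp_subgroup[OF pcore_normal]] by (auto simp: set_mult_def)
    then show "x \<in> ?Q" using \<open>x \<in> P\<close> PG by auto
  qed
  moreover have "finite ?Q" using Q assms(1) subgroup.subset finite_subset by blast
  ultimately have "P = ?Q" using card_seteq by metis
  moreover have "pcore p G \<subseteq> ?Q"
  proof
    fix x assume "x \<in> pcore p G"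
    then have "x \<otimes> \<one> \<in> ?Q" using subgroup.one_closed[OF assms(3)] by (auto simp: set_mult_def)
    then show "x \<in> ?Q" using \<open>x \<in> pcore p G\<close> OG by auto
  qed
  ultimately show ?thesis by simp
qed

lemma (in group) pcore_Int:
  assumes "prime p" "prime q" "p \<noteq> q" "x \<in> pcore p G" "x \<in> pcore q G"
  shows "x = \<one>"
proof -
  have "x \<in> carrier G"
    using assms(4) pcore_normal normal_imp_subgroup subgroup.mem_carrier by metis
  moreover obtain i j where "x [^] (p ^ i) = \<one>" "x [^] (q ^ j) = \<one>"
    using assms(4,5) p_torsion_pcore unfolding p_torsion_def by metis
  moreover have "coprime (p ^ i) (q ^ j)" using assms by (simp add: primes_coprime)
  ultimately show ?thesis using one_of_coprime_pow by blast
qed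

text \<open>The commutator lies in both normal cores, which meet trivially.\<close>

lemma (in group) pcore_commute:
  assumes "prime p" "prime q" "p \<noteq> q" "x \<in> pcore p G" "y \<in> pcore q G"
  shows "x \<otimes> y \<otimes> inv x = y"
proof -
  interpret P: normal "pcore p G" G by (rule pcore_normal)
  interpret Q: normal "pcore q G" G by (rule pcore_normal)
  have G: "x \<in> carrier G" "y \<in> carrier G" using assms P.subset Q.subset by auto
  have "x \<otimes> (y \<otimes> inv x \<otimes> inv y) \<in> pcore p G" using assms G P.inv_op_closed2 by blast
  moreover have "x \<otimes> y \<otimes> inv x \<otimes> inv y \<in> pcore q G" using assms G Q.inv_op_closed2 by blast
  ultimately have "x \<otimes> y \<otimes> inv x \<otimes> inv y = \<one>"
    using pcore_Int[OF assms(1-3)] G by (simp add: m_assoc)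
  then show ?thesis using G by (metis inv_closed inv_equality inv_inv m_closed)
qed

text \<open>The order of the subgroup generated by the \<open>P p\<close> is divisible by every
  prime power part of the order of \<open>G\<close>. Closure of \<open>M\<close> under products
  suffices because a union of subgroups contains its inverses. This reduces claims about all
  multiplicative elements to Sylow subbraces.\<close>

lemma (in group) carrier_subset_if_sylow_subset:
  assumes fin: "finite (carrier G)"
    and P: "\<And>p. p \<in> prime_factors (order G) \<Longrightarrow> subgroup (P p) G"
      "\<And>p. p \<in> prime_factors (order G) \<Longrightarrow> card (P p) = p ^ multiplicity p (order G)"
    and M: "\<one> \<in> M" "\<And>p. p \<in> prime_factors (order G) \<Longrightarrow> P p \<subseteq> M"
      "\<And>x y. \<lbrakk>x \<in> carrier G; y \<in> carrier G; x \<in> M; y \<in> M\<rbrakk> \<Longrightarrow> x \<otimes> y \<in> M"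
  shows "carrier G \<subseteq> M"
proof -
  let ?U = "\<Union>p\<in>prime_factors (order G). P p"
  let ?H = "generate G ?U"
  have U: "?U \<subseteq> carrier G" using P(1) subgroup.subset by blast
  have H: "subgroup ?H G" by (rule generate_is_subgroup[OF U])
  have HG: "?H \<subseteq> carrier G" by (rule generate_incl[OF U])
  have finH: "finite ?H" using HG fin finite_subset by blast
  have ne: "order G \<noteq> 0" using fin order_gt_0_iff_finite by auto
  have Hne: "card ?H \<noteq> 0" using finH generate.one[of G ?U] by auto
  interpret H: group "G\<lparr>carrier := ?H\<rparr>" by (rule subgroup_imp_group[OF H])
  have "multiplicity p (order G) \<le> multiplicity p (card ?H)" if p: "prime p" for p
  proof (cases "p \<in> prime_factors (order G)")
    case True
    have "P p \<subseteq> ?H" using True generate.incl[of _ ?U G] by blast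
    then have "subgroup (P p) (G\<lparr>carrier := ?H\<rparr>)" using subgroup_incl[OF P(1)[OF True] H] by blast
    from H.lagrange[OF this] have "card (P p) dvd order (G\<lparr>carrier := ?H\<rparr>)"
      by (metis dvd_triv_right)
    then have "p ^ multiplicity p (order G) dvd card ?H"
      using P(2)[OF True] by (simp add: order_def)
    then show ?thesis using Hne p by (metis multiplicity_geI not_prime_unit)
  next
    case False
    then show ?thesis using p by (simp add: prime_factors_multiplicity)
  qed
  then have "order G dvd card ?H" using ne by (intro multiplicity_le_imp_dvd) auto
  then have "card (carrier G) \<le> card ?H" using Hne by (simp add: dvd_imp_le order_def)
  then have "?H = carrier G" using HG fin card_seteq by blast
  moreover have "x \<in> M" if "x \<in> ?H" for x
    using that U
  proof (induction rule: generate_induct_inv_closed)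
    case (mult x y)
    then show ?case using HG M(3) by blast
  next
    case (inv h)
    then show ?case using P(1) subgroup.m_inv_closed by (metis UN_iff)
  qed (use M(1,2) in auto)
  ultimately show ?thesis by blast
qed

section \<open>Sylow subbraces\<close>

text \<open>The rewrites present inherited facts about the additive group in ring notation.\<close>

sublocale skew_brace \<subseteq> A: group "add_monoid X"
  rewrites "carrier (add_monoid X) = carrier X"
    and "monoid.mult (add_monoid X) = add X"
    and "one (add_monoid X) = zero X"
    and "m_inv (add_monoid X) = a_inv X"
  by (rule add_group) (simp_all add: a_inv_def)

sublocale skew_brace \<subseteq> M: group X
  by (rule mult_group)

definition lam :: "('a, 'm) ring_scheme \<Rightarrow> 'a \<Rightarrow> 'a \<Rightarrow> 'a" where
  "lam X g a = \<ominus>\<^bsub>X\<^esub> g \<oplus>\<^bsub>X\<^esub> g \<otimes>\<^bsub>X\<^esub> a"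

text \<open>The additive group is the first, normal factor; the multiplicative group is the second
  and acts on it through \<open>lam\<close>.\<close>

definition semidirect :: "('a, 'm) ring_scheme \<Rightarrow> ('a \<times> 'a) monoid" where
  "semidirect X = \<lparr>carrier = carrier X \<times> carrier X,
    monoid.mult = \<lambda>x y. (fst x \<oplus>\<^bsub>X\<^esub> lam X (snd x) (fst y), snd x \<otimes>\<^bsub>X\<^esub> snd y),
    one = (\<zero>\<^bsub>X\<^esub>, \<one>\<^bsub>X\<^esub>)\<rparr>"

section \<open>The \<lambda>-action and the star operation\<close>

context skew_brace
begin

lemma lam_closed [simp]: "g \<in> carrier X \<Longrightarrow> a \<in> carrier X \<Longrightarrow> lam X g a \<in> carrier X"
  by (simp add: lam_def)

lemma mult_eq_add_lam: "g \<in> carrier X \<Longrightarrow> a \<in> carrier X \<Longrightarrow> g \<otimes> a = g \<oplus> lam X g a"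
  by (simp add: lam_def A.inv_cancel)

text \<open>This is the brace law with \<open>\<ominus> g\<close> added on the left.\<close>

lemma lam_add:
  assumes "g \<in> carrier X" "a \<in> carrier X" "b \<in> carrier X"
  shows "lam X g (a \<oplus> b) = lam X g a \<oplus> lam X g b"
  using assms by (simp add: lam_def brace_distrib a_minus_def A.m_assoc)

text \<open>Expand \<open>g \<otimes> (h \<otimes> a)\<close> with
  \<open>h \<otimes> a = h \<oplus> lam X h a\<close> and the brace law; associativity of
  multiplication does the rest.\<close>

lemma lam_mult:
  assumes "g \<in> carrier X" "h \<in> carrier X" "a \<in> carrier X"
  shows "lam X (g \<otimes> h) a = lam X g (lam X h a)"
proof -
  have "g \<otimes> (h \<otimes> a) = g \<otimes> h \<oplus> lam X g (lam X h a)"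
    using assms brace_distrib[of g h "lam X h a"]
    by (simp add: mult_eq_add_lam[of h a] lam_def[of X g] a_minus_def A.m_assoc)
  then show ?thesis using assms by (simp add: lam_def[of X "g \<otimes> h"] M.m_assoc A.inv_cancel)
qed

lemma lam_one: "a \<in> carrier X \<Longrightarrow> lam X \<one> a = a"
  using A.inv_one by (simp add: lam_def flip: zero_eq_one)

lemma lam_hom: "g \<in> carrier X \<Longrightarrow> lam X g \<in> hom (add_monoid X) (add_monoid X)"
  by (auto simp: hom_def lam_add)

lemma lam_zero: "g \<in> carrier X \<Longrightarrow> lam X g \<zero> = \<zero>"
  using hom_one[OF lam_hom A.is_group A.is_group] by simp

lemma lam_surj:
  assumes g: "g \<in> carrier X"
  shows "lam X g ` carrier X = carrier X"
proof
  show "carrier X \<subseteq> lam X g ` carrier X"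
  proof
    fix a assume a: "a \<in> carrier X"
    then have "a = lam X g (lam X (inv g) a)" using g by (simp add: lam_one flip: lam_mult)
    then show "a \<in> lam X g ` carrier X" using a g by auto
  qed
qed (use g in auto)

lemma lam_pow:
  fixes n :: nat
  assumes "g \<in> carrier X" "a \<in> carrier X"
  shows "lam X (g [^] n) a = (lam X g ^^ n) a"
  using assms
proof (induction n arbitrary: a)
  case (Suc n)
  then show ?case by (simp add: lam_mult funpow_swap1)
qed (simp add: lam_one)

lemma star_eq: "star X g a = lam X g a \<ominus> a"
  by (simp add: star_def lam_def)

lemma star_closed [simp]: "g \<in> carrier X \<Longrightarrow> a \<in> carrier X \<Longrightarrow> star X g a \<in> carrier X"
  by (simp add: star_eq a_minus_def)

lemma lam_eq_star: "g \<in> carrier X \<Longrightarrow> a \<in> carrier X \<Longrightarrow> lam X g a = star X g a \<oplus> a"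
  by (simp add: star_eq a_minus_def A.m_assoc)

lemma star_zero: "g \<in> carrier X \<Longrightarrow> star X g \<zero> = \<zero>"
  by (simp add: star_eq lam_zero a_minus_def)

lemma star_one: "a \<in> carrier X \<Longrightarrow> star X \<one> a = \<zero>"
  by (simp add: star_eq lam_one a_minus_def)

text \<open>This identity lets statements about \<open>star X g\<close> be checked for
  \<open>g\<close> in a multiplicative generating set.\<close>

lemma star_mult:
  assumes "g \<in> carrier X" "h \<in> carrier X" "a \<in> carrier X"
  shows "star X (g \<otimes> h) a = star X g (star X h a) \<oplus> star X h a \<oplus> star X g a"
proof -
  have "star X (g \<otimes> h) a = lam X g (star X h a \<oplus> a) \<ominus> a"
    using assms by (simp add: star_eq[of "g \<otimes> h"] lam_mult lam_eq_star[of h])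
  also have "\<dots> = star X g (star X h a) \<oplus> star X h a \<oplus> star X g a"
    using assms by (simp add: lam_add lam_eq_star[of g] a_minus_def A.m_assoc)
  finally show ?thesis .
qed

text \<open>Addition need not commute, so the second summand is conjugated by \<open>a\<close>; this
  is why conjugation has to be controlled along the left series.\<close>

lemma star_add:
  assumes "g \<in> carrier X" "a \<in> carrier X" "b \<in> carrier X"
  shows "star X g (a \<oplus> b) = star X g a \<oplus> (a \<oplus> star X g b \<oplus> \<ominus> a)"
  using assms by (simp add: star_eq lam_add a_minus_def A.m_assoc A.inv_cancel A.inv_mult_group)

section \<open>The semidirect product and the existence of Sylow subbraces\<close>

lemma group_semidirect: "group (semidirect X)"
proof (rule groupI)
  fix x assume "x \<in> carrier (semidirect X)"
  then have x: "fst x \<in> carrier X" "snd x \<in> carrier X" by (auto simp: semidirect_def)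
  show "\<one>\<^bsub>semidirect X\<^esub> \<otimes>\<^bsub>semidirect X\<^esub> x = x"
    using x by (simp add: semidirect_def lam_one)
  let ?y = "(lam X (inv (snd x)) (\<ominus> fst x), inv (snd x))"
  have "lam X (inv (snd x)) (\<ominus> fst x \<oplus> fst x) = \<zero>"
    using x lam_zero by simp
  then have "?y \<otimes>\<^bsub>semidirect X\<^esub> x = \<one>\<^bsub>semidirect X\<^esub>"
    using x by (simp add: semidirect_def flip: lam_add)
  moreover have "?y \<in> carrier (semidirect X)" using x by (simp add: semidirect_def)
  ultimately show "\<exists>y\<in>carrier (semidirect X). y \<otimes>\<^bsub>semidirect X\<^esub> x = \<one>\<^bsub>semidirect X\<^esub>" by blast
qed (auto simp: semidirect_def lam_add lam_mult A.m_assoc M.m_assoc)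

text \<open>
  The semidirect product of \<open>(X, +)\<close> by \<open>(X, \<cdot>)\<close> is the product of the complement \<open>{(0, g)}\<close> and the
  diagonal \<open>{(x, x)}\<close>. A \<open>p\<close>-subgroup meeting both in Sylow subgroups meets all three of
  \<open>(X, +)\<close>, \<open>(X, \<cdot>)\<close> and the diagonal in the same subset of \<open>X\<close>.
\<close>

theorem sylow_subbrace_exists:
  assumes fin: "finite (carrier X)" and p: "prime p"
  shows "\<exists>P. P \<in> sylow_subbraces p X"
proof -
  interpret H: group "semidirect X" by (rule group_semidirect)
  let ?H = "semidirect X"
  let ?m = "p ^ multiplicity p (order X)"
  \<comment> \<open>Embeddings of the complement, the diagonal and the normal factor. The diagonal
    map is a homomorphism because \<open>x \<otimes> y = x \<oplus> lam X x y\<close>.\<close>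
  define iG where "iG = (\<lambda>g::'a. (\<zero>, g))"
  define iD where "iD = (\<lambda>x::'a. (x, x))"
  define iA where "iA = (\<lambda>a::'a. (a, \<one>))"
  have inj: "inj_on iG C" "inj_on iD C" for C by (auto simp: inj_on_def iG_def iD_def)
  interpret iG: group_hom X ?H iG
    by (simp add: group_hom_def group_hom_axioms_def)
      (auto simp: hom_def iG_def semidirect_def lam_zero)
  interpret iD: group_hom X ?H iD
    by (simp add: group_hom_def group_hom_axioms_def)
      (auto simp: hom_def iD_def semidirect_def mult_eq_add_lam)
  interpret iA: group_hom "add_monoid X" ?H iA
    by (simp add: group_hom_def group_hom_axioms_def)
      (auto simp: hom_def iA_def semidirect_def lam_one)
  interpret snd: group_hom ?H X snd
    by (simp add: group_hom_def group_hom_axioms_def)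
      (auto simp: hom_def semidirect_def)
  let ?U = "iG ` carrier X" and ?V = "iD ` carrier X"
  have finH: "finite (carrier ?H)" using fin by (simp add: semidirect_def)
  have UV: "carrier ?H \<subseteq> ?U <#>\<^bsub>?H\<^esub> ?V"
  proof
    fix z assume "z \<in> carrier ?H"
    then obtain a g where z: "z = (a, g)" "a \<in> carrier X" "g \<in> carrier X"
      by (auto simp: semidirect_def)
    \<comment> \<open>Solving \<open>(a, g) = (0, h) (x, x)\<close> requires
      \<open>h \<otimes> x = g\<close> and \<open>lam X h x = a\<close>, that is
      \<open>\<ominus> h \<oplus> g = a\<close>; this forces
      \<open>h = g \<ominus> a\<close>.\<close>
    let ?h = "g \<ominus> a" and ?x = "inv (g \<ominus> a) \<otimes> g"
    have hx: "?h \<in> carrier X" "?x \<in> carrier X" using z by (auto simp: a_minus_def)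
    have "?h \<otimes> ?x = g" using z hx by (simp add: M.inv_cancel)
    moreover from this have "lam X ?h ?x = a"
      using z by (simp add: lam_def) (simp add: a_minus_def A.inv_mult_group A.m_assoc)
    ultimately have "z = iG ?h \<otimes>\<^bsub>?H\<^esub> iD ?x"
      using z hx by (simp add: iG_def iD_def semidirect_def)
    then show "z \<in> ?U <#>\<^bsub>?H\<^esub> ?V" using hx by (auto simp: set_mult_def)
  qed
  obtain S where S: "subgroup S ?H" "p_torsion p ?H S" "card (S \<inter> ?U) = ?m" "card (S \<inter> ?V) = ?m"
    using H.factorized_sylow[OF finH p iG.img_is_subgroup iD.img_is_subgroup UV]
    by (auto simp: order_def card_image[OF inj(1)] card_image[OF inj(2)])
  define P where "P = snd ` S"
  have SH: "S \<subseteq> carrier ?H" using S(1) subgroup.subset by auto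
  have PX: "P \<subseteq> carrier X" using SH by (auto simp: P_def semidirect_def)
  have finP: "finite P" using PX fin finite_subset by blast
  have Psub: "subgroup P X" unfolding P_def by (rule snd.subgroup_img_is_subgroup[OF S(1)])
  have "p_torsion p X P"
    unfolding p_torsion_def P_def
  proof
    fix x assume "x \<in> snd ` S"
    then obtain s where s: "s \<in> S" "x = snd s" by auto
    then obtain k where "s [^]\<^bsub>?H\<^esub> (p ^ k) = \<one>\<^bsub>?H\<^esub>" using S(2) by (auto simp: p_torsion_def)
    then show "\<exists>k::nat. x [^] (p ^ k) = \<one>"
      using snd.hom_nat_pow[of s "p ^ k"] s SH by (metis snd.hom_one subsetD)
  qed
  then have cP: "card P \<le> ?m" using M.card_p_torsion_le[OF Psub fin p] by simp
  \<comment> \<open>For any section \<open>i\<close> of \<open>snd\<close>, the preimage of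
    \<open>S\<close> lies in its projection \<open>P\<close>; it has \<open>?m\<close> elements and
    \<open>P\<close> has at most that many.\<close>
  have eq: "{g \<in> carrier X. i g \<in> S} = P"
    if i: "\<And>g. snd (i g) = g" and c: "card (S \<inter> i ` carrier X) = ?m" for i :: "'a \<Rightarrow> 'a \<times> 'a"
  proof -
    have "inj_on i C" for C by (rule inj_on_inverseI[of _ snd]) (simp add: i)
    moreover have "S \<inter> i ` carrier X = i ` {g \<in> carrier X. i g \<in> S}" by auto
    ultimately have "card {g \<in> carrier X. i g \<in> S} = ?m" using c by (simp add: card_image)
    moreover have "{g \<in> carrier X. i g \<in> S} \<subseteq> P" using i unfolding P_def by (auto intro: rev_image_eqI)
    ultimately show ?thesis using card_seteq[OF finP] cP by presburger
  qed
  have PG: "{g \<in> carrier X. iG g \<in> S} = P" using eq[of iG] S(3) by (simp add: iG_def)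
  have PD: "{g \<in> carrier X. iD g \<in> S} = P" using eq[of iD] S(4) by (simp add: iD_def)
  have cardP: "card P = ?m"
  proof -
    have "S \<inter> ?U = iG ` P" using PG by auto
    then show ?thesis using S(3) by (simp add: card_image[OF inj(1)])
  qed
  define B where "B = {a \<in> carrier X. iA a \<in> S}"
  have Bsub: "subgroup B (add_monoid X)"
    using iA.subgroup_vimage[OF S(1)] by (simp add: B_def)
  have "p_torsion p (add_monoid X) B"
    unfolding p_torsion_def
  proof
    fix a assume a: "a \<in> B"
    then obtain k where k: "iA a [^]\<^bsub>?H\<^esub> (p ^ k) = \<one>\<^bsub>?H\<^esub>"
      using S(2) by (auto simp: p_torsion_def B_def)
    have "iA (a [^]\<^bsub>add_monoid X\<^esub> (p ^ k)) = \<one>\<^bsub>?H\<^esub>"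
      using iA.hom_nat_pow[of a "p ^ k"] a k by (simp add: B_def)
    then have "a [^]\<^bsub>add_monoid X\<^esub> (p ^ k) = \<zero>" by (simp add: iA_def semidirect_def)
    then show "\<exists>k::nat. a [^]\<^bsub>add_monoid X\<^esub> (p ^ k) = \<one>\<^bsub>add_monoid X\<^esub>" by auto
  qed
  then have cB: "card B \<le> ?m"
    using A.card_p_torsion_le[OF Bsub fin p] by (simp add: order_def)
  \<comment> \<open>The quotient of \<open>(x, x)\<close> by \<open>(0, x)\<close> is
    \<open>(x, 1)\<close>. Since \<open>B\<close> has at most \<open>?m\<close> elements, the
    inclusion becomes an equality, and \<open>P\<close> is an additive subgroup as well.\<close>
  have "P \<subseteq> B"
  proof
    fix x assume x: "x \<in> P"
    then have xX: "x \<in> carrier X" and "iG x \<in> S" "iD x \<in> S" using PX PG PD by auto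
    then have "iD x \<otimes>\<^bsub>?H\<^esub> inv\<^bsub>?H\<^esub> iG x \<in> S"
      using subgroup.m_closed[OF S(1)] subgroup.m_inv_closed[OF S(1)] by auto
    moreover have "iD x = iA x \<otimes>\<^bsub>?H\<^esub> iG x"
      using xX by (simp add: iA_def iD_def iG_def semidirect_def lam_one)
    ultimately have "iA x \<in> S" using xX by (simp add: H.m_assoc)
    then show "x \<in> B" using xX by (simp add: B_def)
  qed
  moreover have "finite B" using fin by (simp add: B_def)
  ultimately have "P = B" using card_seteq[of B P] cB cardP by presburger
  then have "subbrace P X" using Bsub Psub by (simp add: subbrace_def)
  then show ?thesis using cardP by (auto simp: sylow_subbraces_def)
qed

section \<open>The left series\<close>

lemma left_series_subgroup: "subgroup (left_series X n) (add_monoid X)"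
proof (induction n rule: induct_nat_012)
  case (ge2 n)
  then have "left_series X (Suc n) \<subseteq> carrier X" using subgroup.subset by fastforce
  then show ?case by (auto intro!: A.generate_is_subgroup)
qed (use A.subgroup_self in auto)

lemma left_series_carrier: "x \<in> left_series X n \<Longrightarrow> x \<in> carrier X"
  using subgroup.mem_carrier[OF left_series_subgroup] by fastforce

lemma left_series_add: "\<lbrakk>x \<in> left_series X n; y \<in> left_series X n\<rbrakk> \<Longrightarrow> x \<oplus> y \<in> left_series X n"
  using subgroup.m_closed[OF left_series_subgroup] by fastforce

lemma left_series_minus: "x \<in> left_series X n \<Longrightarrow> \<ominus> x \<in> left_series X n"
  using subgroup.m_inv_closed[OF left_series_subgroup] unfolding a_inv_def by blast

lemma left_series_zero: "\<zero> \<in> left_series X n"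
  using subgroup.one_closed[OF left_series_subgroup] by simp

lemma star_left_series:
  assumes "n > 0" "g \<in> carrier X" "x \<in> left_series X n"
  shows "star X g x \<in> left_series X (Suc n)"
proof -
  obtain k where "n = Suc k" using assms(1) gr0_conv_Suc by auto
  then show ?thesis using assms by (auto intro!: generate.incl)
qed

text \<open>With \<open>star_left_series\<close> this replaces the recursive equation, which leaves
  the simpset below: inclusions are tested on star generators.\<close>

lemma left_series_SucI:
  assumes K: "subgroup K (add_monoid X)"
    and star: "\<And>g x. \<lbrakk>g \<in> carrier X; x \<in> left_series X (Suc n)\<rbrakk> \<Longrightarrow> star X g x \<in> K"
  shows "left_series X (Suc (Suc n)) \<subseteq> K"
proof -
  have "{star X a x | a x. a \<in> carrier X \<and> x \<in> left_series X (Suc n)} \<subseteq> K" using star by blast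
  then show ?thesis using A.generate_subgroup_incl[OF _ K] by simp
qed

declare left_series.simps(3) [simp del]

text \<open>By \<open>star_mult\<close>, \<open>lam X g\<close> sends a generator
  \<open>star X h y\<close> to
  \<open>star X (g \<otimes> h) y \<oplus> \<ominus> star X g y\<close>.\<close>

lemma lam_left_series:
  assumes g: "g \<in> carrier X"
  shows "x \<in> left_series X n \<Longrightarrow> lam X g x \<in> left_series X n"
proof (induction n arbitrary: x rule: induct_nat_012)
  case (ge2 n)
  interpret l: group_hom "add_monoid X" "add_monoid X" "lam X g"
    using lam_hom[OF g] by (simp add: group_hom_def group_hom_axioms_def)
  have "left_series X (Suc (Suc n))
      \<subseteq> {y \<in> carrier (add_monoid X). lam X g y \<in> left_series X (Suc (Suc n))}"
  proof (rule left_series_SucI[OF l.subgroup_vimage[OF left_series_subgroup]])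
    fix h y assume h: "h \<in> carrier X" and y: "y \<in> left_series X (Suc n)"
    have yX: "y \<in> carrier X" using left_series_carrier y .
    have "star X (g \<otimes> h) y \<oplus> \<ominus> star X g y \<in> left_series X (Suc (Suc n))"
      using star_left_series g h y by (intro left_series_add left_series_minus) auto
    also have "star X (g \<otimes> h) y \<oplus> \<ominus> star X g y = lam X g (star X h y)"
      using g h yX by (simp add: star_mult lam_eq_star[of g "star X h y"] A.m_assoc)
    finally show "star X h y \<in> {y \<in> carrier (add_monoid X). lam X g y \<in> left_series X (Suc (Suc n))}"
      using g h yX by simp
  qed
  then show ?case using ge2.prems by blast
qed (use g in auto)

text \<open>Each term is invariant under \<open>lam X g\<close>, hence contains
  \<open>lam X g x \<ominus> x\<close> along with \<open>x\<close>.\<close>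

lemma left_series_decreasing: "left_series X (Suc n) \<subseteq> left_series X n"
proof (cases n)
  case (Suc k)
  show ?thesis unfolding Suc
  proof (rule left_series_SucI[OF left_series_subgroup])
    fix g x assume "g \<in> carrier X" "x \<in> left_series X (Suc k)"
    then show "star X g x \<in> left_series X (Suc k)"
      using lam_left_series left_series_add left_series_minus by (simp add: star_eq a_minus_def)
  qed
qed simp

lemma left_series_antimono: "m \<le> n \<Longrightarrow> left_series X n \<subseteq> left_series X m"
  by (rule lift_Suc_antimono_le[of "left_series X"]) (rule left_series_decreasing)

text \<open>Solving \<open>star_add\<close> for its conjugated summand writes the conjugate of a
  generator \<open>star X g b\<close> through \<open>star X g x\<close> and
  \<open>star X g (x \<oplus> b)\<close>.\<close>

lemma left_series_conj:
  assumes x: "x \<in> left_series X n" and y: "y \<in> left_series X (Suc n)"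
  shows "x \<oplus> y \<oplus> \<ominus> x \<in> left_series X (Suc n)"
proof (cases n)
  case 0
  then show ?thesis using x y by simp
next
  case (Suc k)
  have xX: "x \<in> carrier X" using left_series_carrier x .
  have "left_series X (Suc (Suc k))
      \<subseteq> {y \<in> carrier (add_monoid X). x \<oplus> y \<oplus> \<ominus> x \<in> left_series X (Suc (Suc k))}"
  proof (rule left_series_SucI)
    show "subgroup {y \<in> carrier (add_monoid X). x \<oplus> y \<oplus> \<ominus> x \<in> left_series X (Suc (Suc k))} (add_monoid X)"
      using A.subgroup_conj_vimage[OF left_series_subgroup xX] by simp
    fix g b assume g: "g \<in> carrier X" and b: "b \<in> left_series X (Suc k)"
    have bX: "b \<in> carrier X" using left_series_carrier b .
    have "\<ominus> star X g x \<oplus> star X g (x \<oplus> b) \<in> left_series X (Suc (Suc k))"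
      using star_left_series g x b Suc by (intro left_series_add left_series_minus) (auto simp: left_series_add)
    also have "\<ominus> star X g x \<oplus> star X g (x \<oplus> b) = x \<oplus> star X g b \<oplus> \<ominus> x"
      using g xX bX by (simp add: star_add A.inv_cancel)
    finally show "star X g b \<in> {y \<in> carrier (add_monoid X). x \<oplus> y \<oplus> \<ominus> x \<in> left_series X (Suc (Suc k))}"
      using g bX by simp
  qed
  then show ?thesis using y Suc by blast
qed

lemma left_series_normal:
  "left_series X (Suc n) \<lhd> ((add_monoid X)\<lparr>carrier := left_series X n\<rparr>)"
proof -
  interpret L: group "(add_monoid X)\<lparr>carrier := left_series X n\<rparr>"
    by (rule A.subgroup_imp_group[OF left_series_subgroup])
  show ?thesis
  proof (rule L.normal_invI)
    show "subgroup (left_series X (Suc n)) ((add_monoid X)\<lparr>carrier := left_series X n\<rparr>)"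
      using A.subgroup_incl left_series_subgroup left_series_decreasing by blast
    fix x h
    assume "x \<in> carrier ((add_monoid X)\<lparr>carrier := left_series X n\<rparr>)" and h: "h \<in> left_series X (Suc n)"
    then have x: "x \<in> left_series X n" by simp
    have "inv\<^bsub>(add_monoid X)\<lparr>carrier := left_series X n\<rparr>\<^esub> x = \<ominus> x"
      using A.m_inv_consistent[OF left_series_subgroup x] by simp
    then show "x \<otimes>\<^bsub>(add_monoid X)\<lparr>carrier := left_series X n\<rparr>\<^esub> h
        \<otimes>\<^bsub>(add_monoid X)\<lparr>carrier := left_series X n\<rparr>\<^esub>
        inv\<^bsub>(add_monoid X)\<lparr>carrier := left_series X n\<rparr>\<^esub> x \<in> left_series X (Suc n)"
      using left_series_conj[OF x h] by simp
  qed
qed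

text \<open>Descending induction from the trivial term \<open>m\<close>. Each step is
  \<open>displacement_mem_pcore\<close> for \<open>lam X g\<close>, with
  \<open>left_series X n\<close> as the group and the next term as \<open>B\<close>.\<close>

lemma star_mem_pcore_left_series:
  assumes nil: "left_series X m = {\<zero>}"
    and g: "g \<in> carrier X" "g [^] (p ^ r :: nat) = \<one>"
    and n: "0 < n" "n \<le> m" and a: "a \<in> left_series X n"
  shows "star X g a \<in> pcore p ((add_monoid X)\<lparr>carrier := left_series X n\<rparr>)"
  using n(2,1) a
proof (induction n arbitrary: a rule: inc_induct)
  case base
  interpret L: group "(add_monoid X)\<lparr>carrier := left_series X m\<rparr>"
    by (rule A.subgroup_imp_group[OF left_series_subgroup])
  have "\<zero> \<in> pcore p ((add_monoid X)\<lparr>carrier := left_series X m\<rparr>)"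
    using subgroup.one_closed[OF normal_imp_subgroup[OF L.pcore_normal]] by simp
  then show ?case using base.prems nil star_zero g by auto
next
  case (step n)
  let ?L = "(add_monoid X)\<lparr>carrier := left_series X n\<rparr>"
  interpret L: group ?L by (rule A.subgroup_imp_group[OF left_series_subgroup])
  have inv_eq: "inv\<^bsub>?L\<^esub> x = \<ominus> x" if "x \<in> left_series X n" for x
    using A.m_inv_consistent[OF left_series_subgroup that] by simp
  have star_L: "lam X g x \<otimes>\<^bsub>?L\<^esub> inv\<^bsub>?L\<^esub> x = star X g x" if "x \<in> left_series X n" for x
    unfolding inv_eq[OF that] by (simp add: star_eq a_minus_def)
  have "lam X g a \<otimes>\<^bsub>?L\<^esub> inv\<^bsub>?L\<^esub> a \<in> pcore p ?L"
  proof (rule L.displacement_mem_pcore[OF left_series_normal])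
    show "lam X g \<in> hom ?L ?L"
      using lam_left_series[OF g(1)] lam_add[OF g(1)] left_series_carrier by (auto simp: hom_def)
    show "(lam X g ^^ p ^ r) x = x" if "x \<in> carrier ?L" for x
    proof -
      have "x \<in> carrier X" using that left_series_carrier by simp
      then show ?thesis using lam_pow[OF g(1), of x "p ^ r"] g(2) by (simp add: lam_one)
    qed
    show "lam X g x \<otimes>\<^bsub>?L\<^esub> inv\<^bsub>?L\<^esub> x \<in> left_series X (Suc n)" if "x \<in> carrier ?L" for x
      using that star_L star_left_series[OF step.prems(1) g(1)] by simp
    show "lam X g x \<otimes>\<^bsub>?L\<^esub> inv\<^bsub>?L\<^esub> x \<in> pcore p (?L\<lparr>carrier := left_series X (Suc n)\<rparr>)"
      if x: "x \<in> left_series X (Suc n)" for x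
      using step.IH[OF _ x] star_L[of x] x left_series_decreasing[of n] by auto
    show "a \<in> carrier ?L" using step.prems by simp
  qed
  then show ?case using star_L step.prems by simp
qed

lemma star_mem_pcore:
  assumes "left_series X m = {\<zero>}" "0 < m" "g \<in> carrier X" "g [^] (p ^ r :: nat) = \<one>" "a \<in> carrier X"
  shows "star X g a \<in> pcore p (add_monoid X)"
  using star_mem_pcore_left_series[OF assms(1,3,4), of 1] assms(2,5) by simp

section \<open>Left series of subbraces and the left nilpotency class\<close>

lemma subbrace_minus:
  assumes "subbrace S X" "x \<in> S"
  shows "\<ominus>\<^bsub>X\<lparr>carrier := S\<rparr>\<^esub> x = \<ominus> x"
  using A.m_inv_consistent[of S x] assms by (simp add: a_inv_def subbrace_def)

lemma subbrace_star:
  assumes "subbrace S X" "g \<in> S" "x \<in> S"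
  shows "star (X\<lparr>carrier := S\<rparr>) g x = star X g x"
  using assms by (simp add: star_def subbrace_minus a_minus_def)

lemma subbrace_left_series_subgroup:
  assumes "subbrace S X"
  shows "subgroup (left_series (X\<lparr>carrier := S\<rparr>) n) (add_monoid X)"
proof -
  interpret Y: skew_brace "X\<lparr>carrier := S\<rparr>" by (rule subbrace_skew_brace[OF assms])
  have "subgroup S (add_monoid X)" using assms by (simp add: subbrace_def)
  then show ?thesis using A.incl_subgroup[of S] Y.left_series_subgroup[of n] by simp
qed

lemma subbrace_left_series_subset:
  assumes S: "subbrace S X"
  shows "left_series (X\<lparr>carrier := S\<rparr>) n \<subseteq> left_series X n"
proof (induction n rule: induct_nat_012)
  case (ge2 n)
  interpret Y: skew_brace "X\<lparr>carrier := S\<rparr>" by (rule subbrace_skew_brace[OF S])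
  have SX: "S \<subseteq> carrier X" using S subgroup.subset by (auto simp: subbrace_def)
  have SA: "subgroup S (add_monoid X)" using S by (simp add: subbrace_def)
  \<comment> \<open>Intersecting with \<open>S\<close> gives a subgroup of the additive group of the
    subbrace, as \<open>Y.left_series_SucI\<close> requires.\<close>
  have K: "subgroup (S \<inter> left_series X (Suc (Suc n))) (add_monoid (X\<lparr>carrier := S\<rparr>))"
    using A.subgroup_incl[OF A.subgroups_Inter_pair[OF SA left_series_subgroup] SA] by simp
  have "left_series (X\<lparr>carrier := S\<rparr>) (Suc (Suc n)) \<subseteq> S \<inter> left_series X (Suc (Suc n))"
  proof (rule Y.left_series_SucI[OF K])
    fix g x assume g: "g \<in> carrier (X\<lparr>carrier := S\<rparr>)" and x: "x \<in> left_series (X\<lparr>carrier := S\<rparr>) (Suc n)"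
    have "x \<in> S" using Y.left_series_carrier[OF x] by simp
    then have "star (X\<lparr>carrier := S\<rparr>) g x = star X g x" using subbrace_star[OF S] g by simp
    moreover have "star X g x \<in> left_series X (Suc (Suc n))"
      using star_left_series[of "Suc n" g x] g x ge2 SX by auto
    ultimately show "star (X\<lparr>carrier := S\<rparr>) g x \<in> S \<inter> left_series X (Suc (Suc n))"
      using Y.star_closed[OF g Y.left_series_carrier[OF x]] by simp
  qed
  then show ?case by blast
qed (use S subgroup.subset in \<open>force simp: subbrace_def\<close>)+

lemma subbrace_left_nilpotent:
  assumes "subbrace S X" "left_nilpotent X"
  shows "left_nilpotent (X\<lparr>carrier := S\<rparr>)"
proof -
  interpret Y: skew_brace "X\<lparr>carrier := S\<rparr>" by (rule subbrace_skew_brace[OF assms(1)])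
  obtain m where m: "m > 0" "left_series X m = {\<zero>}" using assms(2) by (auto simp: left_nilpotent_def)
  then have "left_series (X\<lparr>carrier := S\<rparr>) m = {\<zero>}"
    using subbrace_left_series_subset[OF assms(1), of m] Y.left_series_zero[of m] by auto
  then show ?thesis using m(1) by (auto simp: left_nilpotent_def)
qed

lemma left_series_eq_zero:
  assumes "left_nilpotent X" "left_class X < n"
  shows "left_series X n = {\<zero>}"
proof -
  obtain m where m: "m > 0" "left_series X m = {\<zero>}" using assms(1) by (auto simp: left_nilpotent_def)
  \<comment> \<open>Vanishing one index further makes \<open>m\<close> itself a positive candidate
    for the \<open>LEAST\<close> in \<open>left_class\<close>.\<close>
  have "left_series X (m + 1) = {\<zero>}"
    using left_series_decreasing[of m] left_series_zero[of "m + 1"] m(2) by auto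
  then have "\<exists>n. n > 0 \<and> left_series X (n + 1) = {\<zero>}" using m(1) by blast
  then have "left_series X (left_class X + 1) = {\<zero>}"
    unfolding left_class_def by (metis (mono_tags, lifting) LeastI_ex)
  then show ?thesis
    using left_series_antimono[of "left_class X + 1" n] left_series_zero[of n] assms(2) by auto
qed

text \<open>The extra index is spent on the first star product, which brings all of \<open>X\<close>
  into the sum of the cores; after that every step descends in all Sylow subbraces
  simultaneously.\<close>

lemma left_series_bound:
  assumes fin: "finite (carrier X)" and nil: "0 < m" "left_series X m = {\<zero>}"
    and P: "\<And>p. p \<in> prime_factors (order X) \<Longrightarrow> P p \<in> sylow_subbraces p X"
    and c: "\<And>p. p \<in> prime_factors (order X) \<Longrightarrow> left_series (X\<lparr>carrier := P p\<rparr>) (Suc c) = {\<zero>}"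
  shows "left_series X (Suc (Suc c)) = {\<zero>}"
proof -
  define \<pi> where "\<pi> = prime_factors (order X)"
  define core where "core p = pcore p (add_monoid X)" for p
  define L where "L p = left_series (X\<lparr>carrier := P p\<rparr>)" for p
  define D where "D p n = core p \<inter> L p n" for p n
  define T where "T n = generate (add_monoid X) (\<Union>p\<in>\<pi>. D p n)" for n
  have prime: "prime p" if "p \<in> \<pi>" for p using that by (auto simp: \<pi>_def)
  have sb: "subbrace (P p) X" and cardP: "card (P p) = p ^ multiplicity p (order X)" if "p \<in> \<pi>" for p
    using P that by (auto simp: \<pi>_def sylow_subbraces_def)
  have PX: "P p \<subseteq> carrier X" if "p \<in> \<pi>" for p
    using sb[OF that] subgroup.subset by (auto simp: subbrace_def)
  have On: "core p \<lhd> add_monoid X" for p unfolding core_def by (rule A.pcore_normal)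
  have OX: "core p \<subseteq> carrier X" for p
    using subgroup.subset[OF normal_imp_subgroup[OF On]] by simp
  have sD: "subgroup (D p n) (add_monoid X)" if "p \<in> \<pi>" for p n
    unfolding D_def L_def
    by (rule A.subgroups_Inter_pair[OF normal_imp_subgroup[OF On] subbrace_left_series_subgroup[OF sb[OF that]]])
  have DX: "(\<Union>p\<in>\<pi>. D p n) \<subseteq> carrier X" for n using OX by (auto simp: D_def)
  have Dminus: "\<ominus> x \<in> (\<Union>p\<in>\<pi>. D p n)" if "x \<in> (\<Union>p\<in>\<pi>. D p n)" for x n
    using that subgroup.m_inv_closed[OF sD] unfolding a_inv_def by blast
  have Dadd: "x \<oplus> y \<in> D p n" if "p \<in> \<pi>" "x \<in> D p n" "y \<in> D p n" for p x y n
    using subgroup.m_closed[OF sD] that by fastforce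
  have Pcore_star: "star X g a \<in> core p" if p: "p \<in> \<pi>" and g: "g \<in> P p" and a: "a \<in> carrier X" for p g a
  proof -
    have "p_torsion p X (P p)"
      using M.p_torsion_if_card[OF _ cardP[OF p]] sb[OF p] by (simp add: subbrace_def)
    then obtain r where "g [^] (p ^ r :: nat) = \<one>" using g by (auto simp: p_torsion_def)
    then show ?thesis unfolding core_def using star_mem_pcore[OF nil(2,1)] p g a PX by blast
  qed
  \<comment> \<open>The additive core is preserved by the automorphisms
    \<open>lam X g\<close>.\<close>
  have Ostar: "star X g a \<in> core p" if "g \<in> carrier X" "a \<in> core p" for g a p
  proof -
    have "lam X g a \<in> core p"
      using A.pcore_hom_closed[OF lam_hom[OF that(1)], of a p] lam_surj that unfolding core_def by simp
    moreover have "\<ominus> a \<in> core p"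
      using subgroup.m_inv_closed[OF normal_imp_subgroup[OF On] that(2)] by (simp add: a_inv_def)
    ultimately show ?thesis
      using subgroup.m_closed[OF normal_imp_subgroup[OF On]] by (simp add: star_eq a_minus_def)
  qed
  have OP: "core p \<subseteq> P p" if "p \<in> \<pi>" for p
    unfolding core_def
    using A.pcore_subset_sylow[of p "P p"] fin prime sb cardP that by (simp add: subbrace_def order_def)
  have all_by_sylow: "carrier X \<subseteq> M"
    if "\<one> \<in> M" "\<And>p. p \<in> \<pi> \<Longrightarrow> P p \<subseteq> M"
      "\<And>x y. \<lbrakk>x \<in> carrier X; y \<in> carrier X; x \<in> M; y \<in> M\<rbrakk> \<Longrightarrow> x \<otimes> y \<in> M" for M
    by (rule M.carrier_subset_if_sylow_subset[OF fin, of P])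
      (use sb cardP that in \<open>auto simp: \<pi>_def subbrace_def\<close>)
  have Ddec: "D p (Suc n) \<subseteq> D p n" if "p \<in> \<pi>" for p n
  proof -
    interpret Y: skew_brace "X\<lparr>carrier := P p\<rparr>" by (rule subbrace_skew_brace[OF sb[OF that]])
    show ?thesis using Y.left_series_decreasing by (auto simp: D_def L_def)
  qed
  have Dstar: "star X g x \<in> D p (Suc n)"
    if p: "p \<in> \<pi>" and n: "0 < n" and x: "x \<in> D p n" and g: "g \<in> carrier X" for p n x g
  proof -
    \<comment> \<open>Quantifying over all \<open>x\<close> inside \<open>?M\<close> gives closure
      under products: \<open>star_mult\<close> applies \<open>g\<close> to
      \<open>star X h x\<close>, which lies in \<open>D p (Suc n)\<close> and so again in
      \<open>D p n\<close>.\<close>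
    let ?M = "{g \<in> carrier X. \<forall>x\<in>D p n. star X g x \<in> D p (Suc n)}"
    have "carrier X \<subseteq> ?M"
    proof (rule all_by_sylow)
      show "\<one> \<in> ?M"
        using DX p subgroup.one_closed[OF sD[OF p]] by (fastforce simp: star_one)
    next
      fix q assume q: "q \<in> \<pi>"
      show "P q \<subseteq> ?M"
      proof (intro subsetI CollectI conjI ballI)
        fix g assume g: "g \<in> P q"
        show gX: "g \<in> carrier X" using g PX q by blast
        fix y assume y: "y \<in> D p n"
        have yO: "y \<in> core p" "y \<in> carrier X" using y OX by (auto simp: D_def)
        show "star X g y \<in> D p (Suc n)"
        proof (cases "q = p")
          case True
          interpret Y: skew_brace "X\<lparr>carrier := P p\<rparr>" by (rule subbrace_skew_brace[OF sb[OF p]])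
          have "y \<in> L p n" using y by (simp add: D_def)
          then have "star (X\<lparr>carrier := P p\<rparr>) g y \<in> L p (Suc n)"
            unfolding L_def using Y.star_left_series[OF n] g True by simp
          moreover have "star (X\<lparr>carrier := P p\<rparr>) g y = star X g y"
            using subbrace_star[OF sb[OF p]] g OP[OF p] yO True by blast
          ultimately show ?thesis using Ostar[OF gX yO(1)] by (simp add: D_def)
        next
          case False
          \<comment> \<open>Elements of a Sylow subbrace for another prime act trivially on the
            core, since distinct cores intersect in zero.\<close>
          have "star X g y \<in> core q" using Pcore_star[OF q g] yO by blast
          moreover have "star X g y \<in> core p" using Ostar[OF gX yO(1)] .
          ultimately have "star X g y = \<zero>"
            using A.pcore_Int[of p q] prime p q False unfolding core_def by metis
          then show ?thesis using subgroup.one_closed[OF sD[OF p]] by simp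
        qed
      qed
    next
      fix g h assume gh: "g \<in> carrier X" "h \<in> carrier X" "g \<in> ?M" "h \<in> ?M"
      have "star X (g \<otimes> h) y \<in> D p (Suc n)" if y: "y \<in> D p n" for y
      proof -
        have "y \<in> carrier X" using y DX p by blast
        moreover have "star X h y \<in> D p (Suc n)" using y gh by blast
        moreover from this have "star X g (star X h y) \<in> D p (Suc n)" using Ddec[OF p] gh by blast
        moreover have "star X g y \<in> D p (Suc n)" using y gh by blast
        ultimately show ?thesis using star_mult gh Dadd[OF p] by simp
      qed
      then show "g \<otimes> h \<in> ?M" using gh by simp
    qed
    then show ?thesis using g x by blast
  qed
  have sT: "subgroup (T n) (add_monoid X)" for n
    unfolding T_def using DX by (intro A.generate_is_subgroup) auto
  have TX: "T n \<subseteq> carrier X" for n using subgroup.subset[OF sT] by simp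
  have Tadd: "x \<oplus> y \<in> T n" if "x \<in> T n" "y \<in> T n" for x y n
    using subgroup.m_closed[OF sT] that by fastforce
  have Tzero: "\<zero> \<in> T n" for n using subgroup.one_closed[OF sT] by simp
  have DT: "D p n \<subseteq> T n" if "p \<in> \<pi>" for p n
    unfolding T_def using that generate.incl[of _ "\<Union>p\<in>\<pi>. D p n"] by blast
  \<comment> \<open>For equal primes the conjugation takes place inside one Sylow subbrace; for
    distinct primes the cores commute.\<close>
  have Dconj: "x \<oplus> y \<oplus> \<ominus> x \<in> T (Suc n)"
    if pq: "p \<in> \<pi>" "q \<in> \<pi>" and x: "x \<in> D q n" and y: "y \<in> D p (Suc n)" for p q x y n
  proof (cases "q = p")
    case True
    interpret Y: skew_brace "X\<lparr>carrier := P p\<rparr>" by (rule subbrace_skew_brace[OF sb[OF pq(1)]])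
    have "x \<in> L p n" "y \<in> L p (Suc n)" using x y True by (auto simp: D_def)
    then have "x \<oplus> y \<oplus> (\<ominus>\<^bsub>X\<lparr>carrier := P p\<rparr>\<^esub> x) \<in> L p (Suc n)"
      unfolding L_def using Y.left_series_conj[of x n y] by simp
    moreover have "x \<in> P p" using Y.left_series_carrier \<open>x \<in> L p n\<close> by (auto simp: L_def)
    moreover have "x \<oplus> y \<oplus> \<ominus> x \<in> core p"
      using normal.inv_op_closed2[OF On, of x y p] x y OX by (auto simp: D_def a_inv_def)
    ultimately have "x \<oplus> y \<oplus> \<ominus> x \<in> D p (Suc n)"
      using subbrace_minus[OF sb[OF pq(1)]] by (simp add: D_def)
    then show ?thesis using DT pq by blast
  next
    case False
    then have "x \<oplus> y \<oplus> \<ominus> x = y"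
      using A.pcore_commute[of q p x y] prime pq x y by (simp add: D_def core_def)
    then show ?thesis using DT pq y by auto
  qed
  have Tconj: "x \<oplus> y \<oplus> \<ominus> x \<in> T (Suc n)" if x: "x \<in> T n" and y: "y \<in> T (Suc n)" for x y n
    using x DX[of n] y unfolding T_def[of n]
  proof (induction arbitrary: y rule: A.generate_induct_inv_closed)
    case (inv h)
    then show ?case by (rule Dminus)
  next
    case one
    then have "y \<in> carrier X" using TX by blast
    then show ?case using one A.inv_one by simp
  next
    case (incl x)
    then have xX: "x \<in> carrier X" using DX by blast
    have "T (Suc n) \<subseteq> {y \<in> carrier X. x \<oplus> y \<oplus> \<ominus> x \<in> T (Suc n)}"
      unfolding T_def[of "Suc n"]
      by (rule A.generate_subgroup_incl[OF _ A.subgroup_conj_vimage[OF sT[unfolded T_def] xX]])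
        (use Dconj incl DX in \<open>fastforce simp: T_def\<close>)
    then show ?case using incl by blast
  next
    case (mult x1 x2)
    then have "x1 \<in> T n" "x2 \<in> T n" by (auto simp: T_def)
    then have "x1 \<in> carrier X" "x2 \<in> carrier X" "y \<in> carrier X" using TX mult.prems by blast+
    then have "x1 \<oplus> x2 \<oplus> y \<oplus> \<ominus> (x1 \<oplus> x2) = x1 \<oplus> (x2 \<oplus> y \<oplus> \<ominus> x2) \<oplus> \<ominus> x1"
      by (simp add: A.inv_mult_group A.m_assoc)
    then show ?case using mult.IH mult.prems by simp
  qed
  \<comment> \<open>On a sum, \<open>star_add\<close> produces a conjugated term, which
    \<open>Tconj\<close> keeps in \<open>T (Suc n)\<close>.\<close>
  have Tstar: "star X g x \<in> T (Suc n)" if n: "0 < n" and x: "x \<in> T n" and g: "g \<in> carrier X" for x n g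
    using x DX[of n] unfolding T_def[of n]
  proof (induction rule: A.generate_induct_inv_closed)
    case (inv h)
    then show ?case by (rule Dminus)
  next
    case one
    then show ?case using Tzero by (simp add: star_zero g)
  next
    case (incl x)
    then show ?case using Dstar[OF _ n _ g] DT by blast
  next
    case (mult x1 x2)
    then have T: "x1 \<in> T n" "x2 \<in> T n" by (auto simp: T_def)
    then have "star X g (x1 \<oplus> x2) = star X g x1 \<oplus> (x1 \<oplus> star X g x2 \<oplus> \<ominus> x1)"
      using star_add[OF g] TX by blast
    then show ?case using Tadd mult.IH Tconj[OF T(1)] by simp
  qed
  \<comment> \<open>Here \<open>D p 1\<close> is the full core, because \<open>L p 1 = P p\<close>
    contains it.\<close>
  have base: "star X g a \<in> T 1" if g: "g \<in> carrier X" and a: "a \<in> carrier X" for g a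
  proof -
    have "carrier X \<subseteq> {g \<in> carrier X. \<forall>a\<in>carrier X. star X g a \<in> T 1}"
    proof (rule all_by_sylow)
      show "\<one> \<in> {g \<in> carrier X. \<forall>a\<in>carrier X. star X g a \<in> T 1}"
        using Tzero by (simp add: star_one)
      show "P p \<subseteq> {g \<in> carrier X. \<forall>a\<in>carrier X. star X g a \<in> T 1}" if p: "p \<in> \<pi>" for p
        using Pcore_star[OF p] OP[OF p] DT[OF p, of 1] PX[OF p] by (auto simp: D_def L_def)
    qed (use star_mult Tadd in auto)
    then show ?thesis using g a by blast
  qed
  have "left_series X (Suc n) \<subseteq> T n" if "0 < n" for n
    using that
  proof (induction n rule: nat_induct_non_zero)
    case 1
    show ?case using left_series_SucI[OF sT, of 0 1] base by simp
  next
    case (Suc n)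
    show ?case using left_series_SucI[OF sT, of n "Suc n"] Tstar[OF Suc.hyps] Suc.IH by blast
  qed
  then have "left_series X (Suc (Suc c)) \<subseteq> T (Suc c)" by blast
  also have "T (Suc c) \<subseteq> {\<zero>}"
    unfolding T_def using A.generate_subgroup_incl[OF _ A.triv_subgroup, of "\<Union>p\<in>\<pi>. D p (Suc c)"] c
    by (auto simp: D_def L_def \<pi>_def)
  finally show ?thesis using left_series_zero by blast
qed

end

theorem theoremB:
  fixes X :: "('a, 'm) ring_scheme"
  assumes "skew_brace X"
    and "finite (carrier X)"
    and "left_nilpotent X"
  shows "left_class X \<le>
    Max (insert 0 {left_class (X\<lparr>carrier := P\<rparr>) | p P.
      p \<in> prime_factors (order X) \<and> P \<in> sylow_subbraces p X}) + 1"
proof -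
  interpret skew_brace X by fact
  let ?S = "{left_class (X\<lparr>carrier := P\<rparr>) | p P.
      p \<in> prime_factors (order X) \<and> P \<in> sylow_subbraces p X}"
  \<comment> \<open>If \<open>X\<close> is trivial there are no primes and \<open>c\<close> is 0;
    the bound then reads 1, the least value of \<open>left_class\<close>.\<close>
  define c where "c = Max (insert 0 ?S)"
  \<comment> \<open>\<open>Max\<close> is meaningful only for finite sets; the classes are indexed
    by subsets of the finite carrier.\<close>
  have "?S \<subseteq> (\<lambda>P. left_class (X\<lparr>carrier := P\<rparr>)) ` Pow (carrier X)"
    using subgroup.subset by (fastforce simp: sylow_subbraces_def subbrace_def)
  then have finS: "finite ?S" using assms(2) finite_subset by blast
  obtain m where m: "0 < m" "left_series X m = {\<zero>\<^bsub>X\<^esub>}"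
    using assms(3) by (auto simp: left_nilpotent_def)
  \<comment> \<open>Existence ensures that every prime divisor is represented in the maximum; one
    Sylow subbrace per prime is enough.\<close>
  have "\<exists>P. P \<in> sylow_subbraces p X" if "p \<in> prime_factors (order X)" for p
    using sylow_subbrace_exists[OF assms(2)] that by blast
  then obtain P where P: "\<And>p. p \<in> prime_factors (order X) \<Longrightarrow> P p \<in> sylow_subbraces p X"
    by metis
  have "left_series (X\<lparr>carrier := P p\<rparr>) (Suc c) = {\<zero>\<^bsub>X\<^esub>}" if p: "p \<in> prime_factors (order X)" for p
  proof -
    have sb: "subbrace (P p) X" using P[OF p] by (simp add: sylow_subbraces_def)
    interpret Y: skew_brace "X\<lparr>carrier := P p\<rparr>" by (rule subbrace_skew_brace[OF sb])
    have "left_class (X\<lparr>carrier := P p\<rparr>) \<in> ?S" using p P[OF p] by blast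
    then have "left_class (X\<lparr>carrier := P p\<rparr>) \<le> c" unfolding c_def using finS by (intro Max_ge) auto
    then show ?thesis
      using Y.left_series_eq_zero[OF subbrace_left_nilpotent[OF sb assms(3)], of "Suc c"] by simp
  qed
  then have "left_series X (Suc (Suc c)) = {\<zero>\<^bsub>X\<^esub>}"
    using left_series_bound[OF assms(2) m P] by blast
  \<comment> \<open>Vanishing at index \<open>c + 2\<close> makes \<open>c + 1\<close> a candidate,
    since \<open>left_class\<close> tests the term after its argument.\<close>
  then have "left_class X \<le> c + 1" unfolding left_class_def by (intro Least_le) simp
  then show ?thesis by (simp add: c_def)
qed

end
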